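(* Let $(X,\lambda)$ be a standard $\sigma$-finite space, and let $T\in\mathrm{Aut}(X,\lambda)$. Let $D\subseteq X$ be a Borel subset of positive measure (possibly infinite). For any $\varepsilon>0$ we can write $T=T_1T_2T_\varepsilon$, with $T_1$, $T_2$ and $T_\varepsilon$ in $[T]$ satisfying the following: - $\mathrm{supp}\,T_1$ and $\mathrm{supp}\,T_2$ are disjoint and of equal measure; - $\lambda(\mathrm{supp}\,T_1\cap D)=\lambda(\mathrm{supp}\,T_2\cap D)$; - $T_\varepsilon$ is aperiodic on its support, and $\lambda(\mathrm{supp}\,T_\varepsilon)<\varepsilon$.
   Context: A standard $\sigma$-finite space $(X,\lambda)$ is a standard Borel space $X$ with an atomless $\sigma$-finite Borel measure $\lambda$ such that $\lambda(X)=+\infty$. $\mathrm{Aut}(X,\lambda)$ is the group of Borel bijections $T$ of $X$ with $\lambda(T(A))=\lambda(T^{-1}(A))=\lambda(A)$ for every Borel $A$, where two bijections are identified when they coincide on a conull set. The support is $\mathrm{supp}\,T=\{x\in X: T(x)\neq x\}$ (up to null sets). Measures in the statement may be infinite, equality being understood in $[0,+\infty]$. $[T]$ is the smallest full group containing $T$, where a full group is a subgroup $\mathbb{G}\leqslant\mathrm{Aut}(X,\lambda)$ stable under cutting and pasting: if $S\in\mathrm{Aut}(X,\lambda)$ and there are a countable partition $(A_n)$ of $X$ and $S_n\in\mathbb{G}$ with $S_{\restriction A_n}=S_{n\restriction A_n}$ for all $n$, then $S\in\mathbb{G}$. A conservative bijection (one for which almost every point of any positive-measure Borel set returns to that set)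 is aperiodic on its support if almost every point of its support has an infinite orbit (vacuously true for the identity). *)

theory Defs
  imports "HOL-Analysis.Analysis"
begin

text \<open>Automorphisms are represented by genuine bijections of the space of \<open>M\<close>; identification of
  bijections that agree on a conull set is rendered by working almost everywhere. Values outside
  \<open>space M\<close> are irrelevant.\<close>

definition standard_borel :: "'a measure \<Rightarrow> bool" where
  "standard_borel M \<longleftrightarrow>
     (\<exists>X. topspace X = space M \<and> completely_metrizable_space X \<and> second_countable X \<and>
          sets M = sigma_sets (space M) {U. openin X U})"

definition atomless :: "'a measure \<Rightarrow> bool" where
  "atomless M \<longleftrightarrow>
     (\<forall>A\<in>sets M. emeasure M A > 0 \<longrightarrow>
        (\<exists>B\<in>sets M. B \<subseteq> A \<and> 0 < emeasure M B \<and> emeasure M B < emeasure M A))"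

definition standard_sigma_finite_space :: "'a measure \<Rightarrow> bool" where
  "standard_sigma_finite_space M \<longleftrightarrow>
     standard_borel M \<and> sigma_finite_measure M \<and> atomless M \<and> emeasure M (space M) = \<infinity>"

definition Aut :: "'a measure \<Rightarrow> ('a \<Rightarrow> 'a) set" where
  "Aut M = {T. bij_betw T (space M) (space M) \<and> T \<in> measurable M M \<and>
     (\<forall>A\<in>sets M. T ` A \<in> sets M \<and> emeasure M (T ` A) = emeasure M A \<and>
                  emeasure M (T -` A \<inter> space M) = emeasure M A)}"

definition supp :: "'a measure \<Rightarrow> ('a \<Rightarrow> 'a) \<Rightarrow> 'a set" where
  "supp M T = {x \<in> space M. T x \<noteq> x}"

text \<open>The pasting clause, applied to the partition with the single nonempty piece \<open>space M\<close>, makes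
  a full group closed under almost everywhere equality, so that it corresponds to a set of
  classes. Pieces may be empty, which covers finite partitions.\<close>

definition full_group :: "'a measure \<Rightarrow> ('a \<Rightarrow> 'a) set \<Rightarrow> bool" where
  "full_group M G \<longleftrightarrow>
     G \<subseteq> Aut M \<and> id \<in> G \<and>
     (\<forall>S\<in>G. \<forall>T\<in>G. S \<circ> T \<in> G) \<and>
     (\<forall>S\<in>G. inv_into (space M) S \<in> G) \<and>
     (\<forall>S\<in>Aut M. \<forall>(A :: nat \<Rightarrow> 'a set) R.
        range A \<subseteq> sets M \<and> disjoint_family A \<and> (\<Union>n. A n) = space M \<and>
        (\<forall>n. R n \<in> G \<and> (AE x in M. x \<in> A n \<longrightarrow> S x = R n x)) \<longrightarrow> S \<in> G)"

definition generated_full_group :: "'a measure \<Rightarrow> ('a \<Rightarrow> 'a) \<Rightarrow> ('a \<Rightarrow> 'a) set" where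
  "generated_full_group M T = \<Inter> {G. full_group M G \<and> T \<in> G}"

definition conservative :: "'a measure \<Rightarrow> ('a \<Rightarrow> 'a) \<Rightarrow> bool" where
  "conservative M T \<longleftrightarrow>
     (\<forall>A\<in>sets M. emeasure M A > 0 \<longrightarrow> (AE x in M. x \<in> A \<longrightarrow> (\<exists>n\<ge>1. (T ^^ n) x \<in> A)))"

definition orbit :: "'a measure \<Rightarrow> ('a \<Rightarrow> 'a) \<Rightarrow> 'a \<Rightarrow> 'a set" where
  "orbit M T x = range (\<lambda>n. (T ^^ n) x) \<union> range (\<lambda>n. (inv_into (space M) T ^^ n) x)"

definition aperiodic_on_supp :: "'a measure \<Rightarrow> ('a \<Rightarrow> 'a) \<Rightarrow> bool" where
  "aperiodic_on_supp M T \<longleftrightarrow>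
     conservative M T \<and> (AE x in M. x \<in> supp M T \<longrightarrow> infinite (orbit M T x))"

end

theory Submission
  imports Defs "HOL-Probability.Distribution_Functions"
begin

text \<open>On part of the space the orbits of \<open>T\<close> admit a measurable transversal \<open>W\<close>. On the rest there
  is a set \<open>A\<close> of small measure that meets every orbit infinitely often in both directions; let
  \<open>T\<^sub>\<epsilon>\<close> be the first return map of \<open>T\<close> to \<open>A\<close>. There \<open>U = T \<circ> T\<^sub>\<epsilon>\<inverse>\<close> has finite cycles, each
  crossing \<open>A\<close> exactly once, so \<open>W \<union> A\<close> is a transversal for all of \<open>U\<close>. Halving this transversal
  compatibly with the number of points of \<open>supp U\<close> and of \<open>supp U \<inter> D\<close> on each orbit gives a
  \<open>U\<close>-invariant set \<open>Y\<close>, and \<open>T\<^sub>1\<close>, \<open>T\<^sub>2\<close> are the restrictions of \<open>U\<close> to \<open>Y\<close> and its complement.\<close>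

text \<open>\<open>T\<close> itself may leave no useful set invariant: if it is ergodic, invariant
  sets are null or conull and cannot split a support. Removing a small factor first cuts the orbits
  so that the rest has a measurable transversal, and invariant sets are then free to choose, being
  the saturations of arbitrary measurable pieces of it. The point counts take countably many values,
  possibly \<infinity>, so halving each joint level set meets both requirements at once; a half
  \<open>Q\<close> of \<open>B\<close> is compared with \<open>B - Q\<close>, since half of an
  infinite measure determines nothing. The marker comes from an injective measurable
  \<open>\<phi>\<close> whose sublevel sets have finite measure: an orbit attaining its infimum of
  \<open>\<phi>\<close> selects one point, and any other orbit comes arbitrarily close to its
  infimum. \<open>T\<close> need not be conservative; an orbit with a first or a last visit to the
  marker selects that visit and joins the part governed by \<open>W\<close>. Conservativity of
  \<open>T\<^sub>\<epsilon>\<close> comes from its support lying in a set of finite measure.\<close>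

section \<open>Halving measurable sets\<close>

lemma ternary_lt:
  fixes a b :: "nat \<Rightarrow> bool"
  assumes "\<And>i. i < n \<Longrightarrow> a i = b i" "\<not> a n" "b n"
  shows "(\<Sum>i. of_bool (a i) * (1/3)^i) < (\<Sum>i. of_bool (b i) * (1/3 :: real)^i)"
proof -
  have sm: "summable (\<lambda>i. of_bool (c i) * (1/3 :: real)^i)" for c :: "nat \<Rightarrow> bool"
    by (rule summable_comparison_test'[where g = "\<lambda>i. (1/3)^i" and N = 0]) auto
  define d where "d i = of_bool (b i) * (1/3 :: real)^i - of_bool (a i) * (1/3)^i" for i
  have smd: "summable d" unfolding d_def by (intro summable_diff sm)
  have "(\<Sum>i. d i) = (\<Sum>i. d (i + Suc n)) + (\<Sum>i<Suc n. d i)"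
    by (rule suminf_split_initial_segment[OF smd])
  also have "(\<Sum>i<Suc n. d i) = (1/3)^n"
    using assms by (simp add: d_def)
  \<comment> \<open>Losing every later digit costs (1/3)^n / 2, less than the gain of (1/3)^n at the
    first disagreement. In base two cost and gain would agree and codes could collide.\<close>
  also have "(\<Sum>i. d (i + Suc n)) \<ge> (\<Sum>i. - ((1/3)^Suc n * (1/3)^i))"
  proof (rule suminf_le)
    show "summable (\<lambda>i. - ((1/3)^Suc n * (1/3 :: real)^i))"
      by (intro summable_minus summable_mult) simp
    show "summable (\<lambda>i. d (i + Suc n))"
      using smd by (rule summable_ignore_initial_segment)
    show "- ((1/3)^Suc n * (1/3)^i) \<le> d (i + Suc n)" for i
      by (simp add: d_def power_add)
  qed
  moreover have "(\<Sum>i. - ((1/3)^Suc n * (1/3 :: real)^i)) = - ((1/3)^n / 2)"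
  proof -
    have "(\<lambda>i. - ((1/3)^Suc n * (1/3 :: real)^i)) sums - ((1/3)^Suc n * (1 / (1 - 1/3)))"
      by (intro sums_minus sums_mult geometric_sums) simp
    then show ?thesis by (simp add: sums_iff)
  qed
  moreover have "(1/3 :: real)^n > 0" by simp
  ultimately have "(\<Sum>i. d i) > 0"
    by linarith
  moreover have "(\<Sum>i. d i) = (\<Sum>i. of_bool (b i) * (1/3)^i) - (\<Sum>i. of_bool (a i) * (1/3)^i)"
    unfolding d_def by (rule suminf_diff[symmetric]) (intro sm)+
  ultimately show ?thesis by linarith
qed

lemma ternary_inj:
  fixes a b :: "nat \<Rightarrow> bool"
  assumes "(\<Sum>i. of_bool (a i) * (1/3)^i) = (\<Sum>i. of_bool (b i) * (1/3 :: real)^i)"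
  shows "a = b"
proof (rule ccontr)
  assume "a \<noteq> b"
  then have ex: "\<exists>n. a n \<noteq> b n" by auto
  define n where "n = (LEAST n. a n \<noteq> b n)"
  have "a n \<noteq> b n" using LeastI_ex[OF ex] by (simp add: n_def)
  moreover have eq: "a i = b i" if "i < n" for i
    using not_less_Least that by (auto simp: n_def)
  ultimately show False
    using ternary_lt[of n a b] ternary_lt[of n b a] assms by force
qed

text \<open>A countable base separates the points of a metrizable space, so a point is determined by
  the list of basic sets containing it, and the ternary code turns this list into a real
  number.\<close>

lemma standard_borel_injection:
  assumes "standard_borel M"
  obtains g :: "'a \<Rightarrow> real" where "g \<in> borel_measurable M" "inj_on g (space M)"
    "\<And>x. 0 \<le> g x" "\<And>x. g x < 2"
proof -
  obtain X where X: "topspace X = space M" "completely_metrizable_space X" "second_countable X"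
    "sets M = sigma_sets (space M) {U. openin X U}"
    using assms by (auto simp: standard_borel_def)
  obtain \<B> where \<B>: "countable \<B>" "\<And>V. V \<in> \<B> \<Longrightarrow> openin X V"
    "\<And>U x. openin X U \<Longrightarrow> x \<in> U \<Longrightarrow> \<exists>V \<in> \<B>. x \<in> V \<and> V \<subseteq> U"
    using X(3) by (auto simp: second_countable_def)
  \<comment> \<open>The added empty set keeps the enumerated family nonempty, as
    \<open>from_nat_into\<close> requires, and has no effect on separation.\<close>
  define V where "V = from_nat_into (insert {} \<B>)"
  have rV: "range V = insert {} \<B>"
    using \<B>(1) by (simp add: V_def range_from_nat_into)
  have V: "openin X (V n)" for n
    using rV \<B>(2) by (metis insertE openin_empty rangeI)
  then have Vs: "V n \<in> sets M" for n
    using X(4) by auto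
  define g where "g x = (\<Sum>i. of_bool (x \<in> V i) * (1/3)^i :: real)" for x
  have sm: "summable (\<lambda>i. of_bool (c i) * (1/3 :: real)^i)" for c :: "nat \<Rightarrow> bool"
    by (rule summable_comparison_test'[where g = "\<lambda>i. (1/3)^i" and N = 0]) auto
  show ?thesis
  proof
    show "g \<in> borel_measurable M"
    proof -
      have [measurable]: "Measurable.pred M (\<lambda>x. x \<in> V i)" for i
        using Vs by measurable
      show ?thesis unfolding g_def of_bool_def by measurable
    qed
    show "inj_on g (space M)"
    proof (rule inj_onI)
      fix x y assume xy: "x \<in> space M" "y \<in> space M" "g x = g y"
      have "(x \<in> V i) = (y \<in> V i)" for i
        using ternary_inj[OF xy(3)[unfolded g_def]] by meson
      show "x = y"
      proof (rule ccontr)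
        assume "x \<noteq> y"
        then obtain U where "openin X U" "x \<in> U" "y \<notin> U"
          using X(1,2) xy completely_metrizable_imp_metrizable_space metrizable_imp_Hausdorff_space
          by (metis Hausdorff_space_def disjnt_iff)
        then obtain i where "x \<in> V i" "y \<notin> V i"
        proof -
          obtain W where "W \<in> \<B>" "x \<in> W" "W \<subseteq> U"
            using \<B>(3) \<open>openin X U\<close> \<open>x \<in> U\<close> by blast
          moreover then obtain i where "W = V i" using rV by (metis imageE insertI2)
          ultimately show ?thesis using that \<open>y \<notin> U\<close> by auto
        qed
        with \<open>\<And>i. (x \<in> V i) = (y \<in> V i)\<close> show False by auto
      qed
    qed
    show "0 \<le> g x" for x
      unfolding g_def by (intro suminf_nonneg sm) auto
    show "g x < 2" for x
    proof -
      have "g x \<le> (\<Sum>i. (1/3)^i)"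
        unfolding g_def by (intro suminf_le sm) auto
      then show ?thesis by (simp add: suminf_geometric)
    qed
  qed
qed

text \<open>Each piece of a partition into sets of finite measure is sent to its own bounded interval.\<close>

lemma proper_injection:
  assumes "standard_borel M" "sigma_finite_measure M"
  obtains \<phi> :: "'a \<Rightarrow> real" where "\<phi> \<in> borel_measurable M" "inj_on \<phi> (space M)"
    "\<And>x. 0 \<le> \<phi> x" "\<And>t. emeasure M {x\<in>space M. \<phi> x < t} < \<infinity>"
proof -
  interpret sigma_finite_measure M by fact
  obtain g :: "'a \<Rightarrow> real" where g[measurable]: "g \<in> borel_measurable M" "inj_on g (space M)"
    "\<And>x. 0 \<le> g x" "\<And>x. g x < 2"
    using standard_borel_injection[OF assms(1)] by metis
  obtain A :: "nat \<Rightarrow> 'a set" where A: "range A \<subseteq> sets M" "(\<Union>i. A i) = space M"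
    "\<And>i. emeasure M (A i) \<noteq> \<infinity>" "disjoint_family A"
    using sigma_finite_disjoint by metis
  have [measurable]: "A i \<in> sets M" for i using A(1) by auto
  define n where "n x = (LEAST i. x \<in> A i)" for x
  have [measurable]: "n \<in> measurable M (count_space UNIV)"
    unfolding n_def by measurable
  have n: "x \<in> A (n x)" if "x \<in> space M" for x
    using that A(2) unfolding n_def by (metis LeastI UN_iff)
  \<comment> \<open>As \<open>g\<close> takes values in [0, 2), translating by multiples of 2 keeps
    the pieces apart, and a bound on \<open>\<phi>\<close> admits only finitely many of
    them.\<close>
  define \<phi> where "\<phi> x = 2 * real (n x) + g x" for x
  show ?thesis
  proof
    show "\<phi> \<in> borel_measurable M" unfolding \<phi>_def by measurable
    show "inj_on \<phi> (space M)"
    proof (rule inj_onI)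
      fix x y assume xy: "x \<in> space M" "y \<in> space M" "\<phi> x = \<phi> y"
      have "\<bar>real (n x) - real (n y)\<bar> < 1"
        using xy(3) g(3)[of x] g(3)[of y] g(4)[of x] g(4)[of y] unfolding \<phi>_def by linarith
      then have "n x = n y" by linarith
      with xy show "x = y" using g(2) by (auto simp: \<phi>_def inj_on_def)
    qed
    show "0 \<le> \<phi> x" for x using g(3)[of x] by (simp add: \<phi>_def)
    show "emeasure M {x\<in>space M. \<phi> x < t} < \<infinity>" for t
    proof -
      have "emeasure M {x\<in>space M. \<phi> x < t} \<le> emeasure M (\<Union>i\<in>{..nat \<lceil>t\<rceil>}. A i)"
      proof (rule emeasure_mono)
        show "{x \<in> space M. \<phi> x < t} \<subseteq> (\<Union>i\<in>{..nat \<lceil>t\<rceil>}. A i)"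
        proof safe
          fix x assume "x \<in> space M" "\<phi> x < t"
          then have "real (n x) \<le> t" using g(3)[of x] by (simp add: \<phi>_def)
          then have "n x \<le> nat \<lceil>t\<rceil>" by linarith
          then show "x \<in> (\<Union>i\<in>{..nat \<lceil>t\<rceil>}. A i)" using n[OF \<open>x \<in> space M\<close>] by auto
        qed
      qed measurable
      also have "\<dots> \<le> (\<Sum>i\<in>{..nat \<lceil>t\<rceil>}. emeasure M (A i))"
        by (rule emeasure_subadditive_finite) auto
      also have "\<dots> < \<infinity>" using A(3) by (simp add: less_top)
      finally show ?thesis .
    qed
  qed
qed

section \<open>Halving sets and integrals of countably valued densities\<close>

lemma atomless_subset_singleton:
  assumes "atomless M" "A \<in> sets M" "\<And>x y. x \<in> A \<Longrightarrow> y \<in> A \<Longrightarrow> x = y"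
  shows "emeasure M A = 0"
proof (rule ccontr)
  assume "emeasure M A \<noteq> 0"
  then obtain B where B: "B \<in> sets M" "B \<subseteq> A" "0 < emeasure M B" "emeasure M B < emeasure M A"
    using assms(1,2) by (force simp: atomless_def zero_less_iff_neq_zero)
  then have "B \<noteq> {}" by auto
  then have "B = A" using B(2) assms(3) by blast
  then show False using B(4) by simp
qed

text \<open>The image of the measure under the injective \<open>\<phi>\<close> has no point masses
  because \<open>M\<close> is atomless, so its distribution function is continuous and somewhere
  equals half the total mass; \<open>Q\<close> is the part of \<open>B\<close> up to such a
  level.\<close>

lemma halve_finite:
  fixes \<phi> :: "'a \<Rightarrow> real"
  assumes "atomless M" and phi[measurable]: "\<phi> \<in> borel_measurable M" and inj: "inj_on \<phi> (space M)"
    and B[measurable]: "B \<in> sets M" and fin: "emeasure M B \<noteq> \<infinity>"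
  obtains Q where "Q \<in> sets M" "Q \<subseteq> B" "emeasure M Q = emeasure M (B - Q)"
proof -
  define N where "N = distr (restrict_space M B) borel \<phi>"
  have BM: "B \<subseteq> space M" using sets.sets_into_space[OF B] .
  have [measurable]: "\<phi> \<in> borel_measurable (restrict_space M B)"
    by (rule measurable_restrict_space1) measurable
  have emN: "emeasure N E = emeasure M {x\<in>B. \<phi> x \<in> E}" if "E \<in> sets borel" for E
  proof -
    have "emeasure N E = emeasure (restrict_space M B) (\<phi> -` E \<inter> B)"
      unfolding N_def using that BM by (subst emeasure_distr) (auto simp: space_restrict_space Int_absorb2)
    also have "\<dots> = emeasure M (\<phi> -` E \<inter> B)"
      using BM B by (subst emeasure_restrict_space) auto
    also have "\<phi> -` E \<inter> B = {x\<in>B. \<phi> x \<in> E}" by auto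
    finally show ?thesis .
  qed
  have "finite_measure N"
    using fin emN[of UNIV] by (intro finite_measureI) (simp add: N_def)
  then interpret finite_borel_measure N
    by (simp add: finite_borel_measure_def finite_borel_measure_axioms_def N_def)
  have sing: "measure N {t} = 0" for t
  proof -
    have "{x\<in>B. \<phi> x \<in> {t}} = B \<inter> {x\<in>space M. \<phi> x = t}" using BM by auto
    also have "\<dots> \<in> sets M" by measurable
    finally have "emeasure M {x\<in>B. \<phi> x \<in> {t}} = 0"
      using BM by (intro atomless_subset_singleton assms(1)) (auto intro!: inj_onD[OF inj])
    then show ?thesis using emN[of "{t}"] by (simp add: measure_def)
  qed
  have cont: "continuous_on UNIV (cdf N)"
    using sing by (auto simp: continuous_on_eq_continuous_at isCont_cdf)
  have "\<exists>t. cdf N t = measure N (space N) / 2"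
  proof (cases "measure N (space N) = 0")
    case True
    then show ?thesis using cdf_bounded[of 0] cdf_nonneg[of 0] by (intro exI[of _ 0]) simp
  next
    case False
    then have pos: "measure N (space N) > 0" by (simp add: zero_less_measure_iff)
    then have "eventually (\<lambda>t. cdf N t < measure N (space N) / 2) at_bot"
      using cdf_lim_at_bot by (intro order_tendstoD(2)) auto
    then obtain a where a: "cdf N a < measure N (space N) / 2"
      by (metis eventually_at_bot_linorder order_refl)
    have "eventually (\<lambda>t. cdf N t > measure N (space N) / 2) at_top"
      using cdf_lim_at_top pos by (intro order_tendstoD(1)) auto
    then obtain b where b: "cdf N b > measure N (space N) / 2"
      by (metis eventually_at_top_linorder order_refl)
    have "a \<le> b" using a b cdf_nondecreasing[of b a] by linarith
    then show ?thesis
      using IVT'[of "cdf N" a _ b] a b cont by (meson continuous_on_subset less_imp_le subset_UNIV)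
  qed
  then obtain t where t: "cdf N t = measure N (space N) / 2" ..
  define Q where "Q = {x\<in>B. \<phi> x \<le> t}"
  have "Q = B \<inter> {x\<in>space M. \<phi> x \<le> t}" using BM by (auto simp: Q_def)
  then have Q[measurable]: "Q \<in> sets M" by simp
  have QB: "Q \<subseteq> B" by (auto simp: Q_def)
  have "measure N {..t} = measure M Q" "measure N UNIV = measure M B"
    using emN[of "{..t}"] emN[of UNIV] by (simp_all add: measure_def Q_def)
  then have "measure M Q = measure M B / 2"
    using t by (simp add: cdf_def borel_UNIV)
  moreover have "measure M (B - Q) = measure M B - measure M Q"
    using fin by (intro measure_Diff) (use QB in auto)
  ultimately have "measure M Q = measure M (B - Q)" by simp
  moreover have "emeasure M Q \<noteq> \<infinity>" "emeasure M (B - Q) \<noteq> \<infinity>"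
    using fin emeasure_mono[of Q B M] emeasure_mono[of "B - Q" B M]
    by (auto simp: Q_def top_unique)
  ultimately have "emeasure M Q = emeasure M (B - Q)"
    by (simp add: emeasure_eq_ennreal_measure)
  then show ?thesis using that[of Q] Q by (auto simp: Q_def)
qed

text \<open>Each piece of finite measure is halved separately and both sides are summed; no measures
  are subtracted, so \<open>B\<close> may have infinite measure.\<close>

lemma halve_sigma_finite:
  fixes \<phi> :: "'a \<Rightarrow> real"
  assumes "atomless M" "\<phi> \<in> borel_measurable M" "inj_on \<phi> (space M)"
    "sigma_finite_measure M" "B \<in> sets M"
  obtains Q where "Q \<in> sets M" "Q \<subseteq> B" "emeasure M Q = emeasure M (B - Q)"
proof -
  interpret sigma_finite_measure M by fact
  obtain A :: "nat \<Rightarrow> 'a set" where A: "range A \<subseteq> sets M" "(\<Union>i. A i) = space M"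
    "\<And>i. emeasure M (A i) \<noteq> \<infinity>" "disjoint_family A"
    using sigma_finite_disjoint by metis
  have BA: "B \<inter> A i \<in> sets M" for i using A(1) assms(5) by auto
  have fin: "emeasure M (B \<inter> A i) \<noteq> \<infinity>" for i
    using A(3)[of i] emeasure_mono[of "B \<inter> A i" "A i" M] A(1) by (auto simp: top_unique)
  have "\<forall>i. \<exists>Q. Q \<in> sets M \<and> Q \<subseteq> B \<inter> A i \<and> emeasure M Q = emeasure M (B \<inter> A i - Q)"
    using halve_finite[OF assms(1-3) BA fin] by metis
  then obtain Q where Q: "\<And>i. Q i \<in> sets M" "\<And>i. Q i \<subseteq> B \<inter> A i"
    "\<And>i. emeasure M (Q i) = emeasure M (B \<inter> A i - Q i)"
    by metis
  have dA: "i = j" if "x \<in> A i" "x \<in> A j" for i j x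
    using A(4) that unfolding disjoint_family_on_def by blast
  have eq: "B - (\<Union>i. Q i) = (\<Union>i. B \<inter> A i - Q i)" (is "?L = ?R")
  proof
    show "?L \<subseteq> ?R"
    proof
      fix x assume x: "x \<in> ?L"
      then have "x \<in> (\<Union>i. A i)" using A(2) sets.sets_into_space[OF assms(5)] by auto
      with x show "x \<in> ?R" by auto
    qed
    show "?R \<subseteq> ?L"
    proof
      fix x assume "x \<in> ?R"
      then obtain i where i: "x \<in> B" "x \<in> A i" "x \<notin> Q i" by auto
      have "x \<notin> Q j" for j
        using Q(2)[of j] dA[OF i(2), of j] i(3) by auto
      then show "x \<in> ?L" using i(1) by auto
    qed
  qed
  have "emeasure M (\<Union>i. Q i) = (\<Sum>i. emeasure M (Q i))"
    using Q dA by (intro suminf_emeasure[symmetric]) (auto simp: disjoint_family_on_def, blast)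
  also have "\<dots> = (\<Sum>i. emeasure M (B \<inter> A i - Q i))" using Q(3) by simp
  also have "\<dots> = emeasure M (\<Union>i. B \<inter> A i - Q i)"
    using Q dA BA by (intro suminf_emeasure) (auto simp: disjoint_family_on_def)
  finally show ?thesis using that[of "\<Union>i. Q i"] Q eq by fastforce
qed

text \<open>A function of \<open>p\<close> is constant on each level set of \<open>p\<close>, so one
  \<open>Q\<close> halving every level set inside \<open>B\<close> serves all \<open>f\<close> at
  once.\<close>

lemma halve_level_sets:
  fixes \<phi> :: "'a \<Rightarrow> real" and p :: "'a \<Rightarrow> nat"
  assumes "atomless M" "\<phi> \<in> borel_measurable M" "inj_on \<phi> (space M)"
    "sigma_finite_measure M" and B[measurable]: "B \<in> sets M"
    and p[measurable]: "p \<in> measurable M (count_space UNIV)"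
  obtains Q where "Q \<in> sets M" "Q \<subseteq> B"
    "\<And>f. (\<integral>\<^sup>+x. f (p x) * indicator Q x \<partial>M) = (\<integral>\<^sup>+x. f (p x) * indicator (B - Q) x \<partial>M)"
proof -
  define P where "P i = B \<inter> {x\<in>space M. p x = i}" for i
  have [measurable]: "P i \<in> sets M" for i unfolding P_def by measurable
  have "\<forall>i. \<exists>Q. Q \<in> sets M \<and> Q \<subseteq> P i \<and> emeasure M Q = emeasure M (P i - Q)"
    using halve_sigma_finite[OF assms(1-4) \<open>P _ \<in> sets M\<close>] by metis
  then obtain R where R: "\<And>i. R i \<in> sets M" "\<And>i. R i \<subseteq> P i"
    "\<And>i. emeasure M (R i) = emeasure M (P i - R i)"
    by metis
  define Q where "Q = (\<Union>i. R i)"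
  have [measurable]: "Q \<in> sets M" using R(1) by (auto simp: Q_def)
  have fib: "P i \<inter> Q = R i" "P i - Q = P i - R i" for i
    using R(2) by (auto simp: Q_def P_def)
  have int: "(\<integral>\<^sup>+x. f (p x) * indicator C x \<partial>M) = (\<Sum>i. f i * emeasure M (P i \<inter> C))"
    if C[measurable]: "C \<in> sets M" and CB: "C \<subseteq> B" for f :: "nat \<Rightarrow> ennreal" and C
  proof -
    have "(\<integral>\<^sup>+x. f (p x) * indicator C x \<partial>M) = (\<integral>\<^sup>+x. (\<Sum>i. f i * indicator (P i \<inter> C) x) \<partial>M)"
    proof (rule nn_integral_cong)
      fix x assume x: "x \<in> space M"
      have "(\<Sum>i. f i * indicator (P i \<inter> C) x) = (\<Sum>i\<in>{p x}. f i * indicator (P i \<inter> C) x)"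
        by (rule suminf_finite) (auto simp: P_def indicator_def)
      also have "\<dots> = f (p x) * indicator C x"
        using x CB by (auto simp: P_def indicator_def)
      finally show "f (p x) * indicator C x = (\<Sum>i. f i * indicator (P i \<inter> C) x)" by simp
    qed
    also have "\<dots> = (\<Sum>i. \<integral>\<^sup>+x. f i * indicator (P i \<inter> C) x \<partial>M)"
      by (rule nn_integral_suminf) measurable
    also have "\<dots> = (\<Sum>i. f i * emeasure M (P i \<inter> C))"
      by (simp add: nn_integral_cmult_indicator)
    finally show ?thesis .
  qed
  have QB: "Q \<subseteq> B" using R(2) by (auto simp: Q_def P_def)
  have "P i \<inter> (B - Q) = P i - Q" for i by (auto simp: P_def)
  then have "(\<integral>\<^sup>+x. f (p x) * indicator Q x \<partial>M) = (\<integral>\<^sup>+x. f (p x) * indicator (B - Q) x \<partial>M)" for f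
    using R(3) by (simp add: int QB fib)
  then show ?thesis using that QB \<open>Q \<in> sets M\<close> by blast
qed

text \<open>Countability of the values lets the pair of densities be coded by a single natural
  number \<open>p x\<close>; both densities are then functions of \<open>p\<close>.\<close>

lemma halve_two_densities:
  fixes \<phi> :: "'a \<Rightarrow> real" and c\<^sub>1 c\<^sub>2 :: "'a \<Rightarrow> ennreal"
  assumes "atomless M" "\<phi> \<in> borel_measurable M" "inj_on \<phi> (space M)"
    "sigma_finite_measure M" and B[measurable]: "B \<in> sets M"
    and c[measurable]: "c\<^sub>1 \<in> borel_measurable M" "c\<^sub>2 \<in> borel_measurable M"
    and V: "countable V" "range c\<^sub>1 \<subseteq> V" "range c\<^sub>2 \<subseteq> V"
  obtains Q where "Q \<in> sets M" "Q \<subseteq> B"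
    "(\<integral>\<^sup>+x. c\<^sub>1 x * indicator Q x \<partial>M) = (\<integral>\<^sup>+x. c\<^sub>1 x * indicator (B - Q) x \<partial>M)"
    "(\<integral>\<^sup>+x. c\<^sub>2 x * indicator Q x \<partial>M) = (\<integral>\<^sup>+x. c\<^sub>2 x * indicator (B - Q) x \<partial>M)"
proof -
  define p where "p x = to_nat_on (V \<times> V) (c\<^sub>1 x, c\<^sub>2 x)" for x
  have VV: "countable (V \<times> V)" using V(1) by simp
  have inv: "from_nat_into (V \<times> V) (p x) = (c\<^sub>1 x, c\<^sub>2 x)" for x
    unfolding p_def using V by (intro from_nat_into_to_nat_on VV) auto
  have [measurable]: "p \<in> measurable M (count_space UNIV)"
  proof (subst measurable_count_space_eq2_countable, safe)
    fix i
    show "p -` {i} \<inter> space M \<in> sets M"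
    proof (cases "\<exists>x. p x = i")
      case True
      then obtain y where y: "p y = i" ..
      have "p x = i \<longleftrightarrow> c\<^sub>1 x = c\<^sub>1 y \<and> c\<^sub>2 x = c\<^sub>2 y" for x
        unfolding y[symmetric] by (metis inv p_def prod.inject)
      then have "p -` {i} \<inter> space M = {x\<in>space M. c\<^sub>1 x = c\<^sub>1 y \<and> c\<^sub>2 x = c\<^sub>2 y}" by auto
      also have "\<dots> \<in> sets M" by measurable
      finally show ?thesis .
    next
      case False
      then have "p -` {i} = {}" by auto
      then show ?thesis by simp
    qed
  qed auto
  obtain Q where Q: "Q \<in> sets M" "Q \<subseteq> B"
    "\<And>f. (\<integral>\<^sup>+x. f (p x) * indicator Q x \<partial>M) = (\<integral>\<^sup>+x. f (p x) * indicator (B - Q) x \<partial>M)"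
    using halve_level_sets[OF assms(1-5) \<open>p \<in> _\<close>] by metis
  show ?thesis
    using that[OF Q(1,2)] Q(3)[of "\<lambda>i. fst (from_nat_into (V \<times> V) i)"]
      Q(3)[of "\<lambda>i. snd (from_nat_into (V \<times> V) i)"] by (simp add: inv)
qed

section \<open>Automorphisms and full groups\<close>

definition zpow :: "('a \<Rightarrow> 'a) \<Rightarrow> int \<Rightarrow> 'a \<Rightarrow> 'a" where
  "zpow T k = (if 0 \<le> k then T ^^ nat k else inv T ^^ nat (- k))"

lemma zpow_0 [simp]: "zpow T 0 x = x"
  by (simp add: zpow_def)

lemma zpow_1 [simp]: "zpow T 1 x = T x"
  by (simp add: zpow_def)

lemma zpow_of_nat: "zpow T (int n) x = (T ^^ n) x"
  by (simp add: zpow_def)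

lemma zpow_succ:
  assumes "bij T"
  shows "zpow T (k + 1) x = T (zpow T k x)"
proof (cases "0 \<le> k")
  case True
  then have "nat (k + 1) = Suc (nat k)" by simp
  then show ?thesis using True by (simp add: zpow_def)
next
  case False
  then have "nat (- k) = Suc (nat (- (k + 1)))" by simp
  then have "zpow T k x = inv T ((inv T ^^ nat (- (k + 1))) x)"
    using False by (simp add: zpow_def)
  then have "T (zpow T k x) = (inv T ^^ nat (- (k + 1))) x"
    using assms by (simp add: bij_is_surj surj_f_inv_f)
  then show ?thesis using False by (cases "k = -1") (auto simp: zpow_def)
qed

lemma zpow_pred:
  assumes "bij T"
  shows "zpow T (k - 1) x = inv T (zpow T k x)"
  using zpow_succ[OF assms, of "k - 1" x] assms by (simp add: bij_is_inj)

lemma zpow_add: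
  assumes "bij T"
  shows "zpow T (i + j) x = zpow T i (zpow T j x)"
proof (induction i rule: int_induct[where k = 0])
  case (step1 i)
  then show ?case using zpow_succ[OF assms] by (metis add.assoc add.commute)
next
  case (step2 i)
  have "i - 1 + j = i + j - 1" by simp
  then show ?case using step2 zpow_pred[OF assms] by metis
qed simp

lemma zpow_minus_cancel [simp]:
  assumes "bij T"
  shows "zpow T (- k) (zpow T k x) = x" "zpow T k (zpow T (- k) x) = x"
  using zpow_add[OF assms, of "- k" k x] zpow_add[OF assms, of k "- k" x] by simp_all

lemma zpow_invariant:
  assumes "bij U" "\<And>x. f (U x) = f x"
  shows "f (zpow U k x) = f x"
proof (induction k rule: int_induct[where k = 0])
  case (step1 i)
  then show ?case by (simp add: zpow_succ assms)
next
  case (step2 i)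
  have "f (U (zpow U (i - 1) x)) = f (zpow U i x)"
    using zpow_succ[OF assms(1), of "i - 1" x] by simp
  with step2 assms(2) show ?case by simp
qed simp

text \<open>The \<open>T\<close>-orbit of \<open>x\<close> stays in \<open>S\<close>, where the two
  maps agree. In the backward step equality is checked after applying \<open>U\<close>, which is
  then cancelled.\<close>

lemma zpow_cong:
  assumes "bij T" "bij U" "\<And>x. T x \<in> S \<longleftrightarrow> x \<in> S" "\<And>x. x \<in> S \<Longrightarrow> U x = T x" "x \<in> S"
  shows "zpow U k x = zpow T k x"
proof (induction k rule: int_induct[where k = 0])
  case (step1 i)
  have "zpow T i x \<in> S"
    using zpow_invariant[of T "\<lambda>x. x \<in> S"] assms by blast
  with step1 show ?case by (simp add: zpow_succ assms)
next
  case (step2 i)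
  have "zpow T (i - 1) x \<in> S"
    using zpow_invariant[of T "\<lambda>x. x \<in> S"] assms by blast
  then have "U (zpow T (i - 1) x) = T (zpow T (i - 1) x)" using assms(4) by blast
  also have "\<dots> = U (zpow U (i - 1) x)"
    using step2 zpow_succ[OF assms(1), of "i - 1" x] zpow_succ[OF assms(2), of "i - 1" x] by simp
  finally show ?case using assms(2) by (simp add: bij_def inj_eq)
qed simp

text \<open>Bijectivity on the whole type makes \<open>inv\<close> a true inverse everywhere, so
  powers, preimages and saturations need no intersection with the space.\<close>

definition bij_aut :: "'a measure \<Rightarrow> ('a \<Rightarrow> 'a) \<Rightarrow> bool" where
  "bij_aut M T \<longleftrightarrow> bij T \<and> T \<in> Aut M"

lemma bij_autI:
  assumes "bij T" "T ` space M = space M"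
    "\<And>A. A \<in> sets M \<Longrightarrow> T ` A \<in> sets M" "\<And>A. A \<in> sets M \<Longrightarrow> emeasure M (T ` A) = emeasure M A"
    "\<And>A. A \<in> sets M \<Longrightarrow> T -` A \<inter> space M \<in> sets M"
  shows "bij_aut M T"
proof -
  have "bij_betw T (space M) (space M)"
    using assms(1,2) by (auto simp: bij_betw_def bij_def intro: inj_on_subset)
  moreover have "emeasure M (T -` A \<inter> space M) = emeasure M A" if "A \<in> sets M" for A
  proof -
    have "A \<subseteq> T ` space M"
      using sets.sets_into_space[OF that] assms(2) by simp
    then have "T ` (T -` A \<inter> space M) = A" by blast
    then show ?thesis using assms(4)[OF assms(5)[OF that]] by simp
  qed
  moreover have "T \<in> measurable M M"
    using assms(2,5) by (intro measurableI) auto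
  ultimately show ?thesis using assms by (auto simp: bij_aut_def Aut_def)
qed

context
  fixes M :: "'a measure" and T :: "'a \<Rightarrow> 'a"
  assumes T: "bij_aut M T"
begin

lemma bij_aut_bij: "bij T"
  using T by (simp add: bij_aut_def)

lemma bij_aut_measurable: "T \<in> measurable M M"
  using T by (simp add: bij_aut_def Aut_def)

lemma bij_aut_image_space: "T ` space M = space M"
  using T by (simp add: bij_aut_def Aut_def bij_betw_def)

lemma bij_aut_space_iff: "T x \<in> space M \<longleftrightarrow> x \<in> space M"
  using bij_aut_image_space bij_aut_bij by (metis bij_is_inj inj_image_mem_iff)

lemma bij_aut_image: "A \<in> sets M \<Longrightarrow> T ` A \<in> sets M"
  using T by (simp add: bij_aut_def Aut_def)

lemma bij_aut_emeasure: "A \<in> sets M \<Longrightarrow> emeasure M (T ` A) = emeasure M A"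
  using T by (simp add: bij_aut_def Aut_def)

lemma bij_aut_vimage: "A \<in> sets M \<Longrightarrow> T -` A \<in> sets M"
proof -
  assume A: "A \<in> sets M"
  then have "T -` A \<subseteq> space M"
    using sets.sets_into_space[OF A] bij_aut_space_iff by auto
  then show ?thesis using measurable_sets[OF bij_aut_measurable A] by (simp add: Int_absorb2)
qed

lemma bij_aut_emeasure_vimage: "A \<in> sets M \<Longrightarrow> emeasure M (T -` A) = emeasure M A"
  using bij_aut_emeasure[OF bij_aut_vimage] bij_aut_bij by (simp add: bij_is_surj surj_image_vimage_eq)

lemma bij_aut_inv: "bij_aut M (inv T)"
proof -
  have im: "inv T ` A = T -` A" for A
    by (simp add: bij_aut_bij bij_vimage_eq_inv_image)
  have vi: "inv T -` A = T ` A" for A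
    using bij_aut_bij by (metis bij_imp_bij_inv bij_vimage_eq_inv_image inv_inv_eq)
  show ?thesis
  proof (rule bij_autI)
    show "bij (inv T)" using bij_aut_bij by (rule bij_imp_bij_inv)
    show "inv T ` space M = space M" using bij_aut_space_iff by (auto simp: im)
    show "inv T -` A \<inter> space M \<in> sets M" if "A \<in> sets M" for A
      unfolding vi using bij_aut_image[OF that] by auto
  qed (simp_all add: im bij_aut_vimage bij_aut_emeasure_vimage)
qed

end

lemma bij_aut_id: "bij_aut M id"
  by (rule bij_autI) auto

lemma bij_aut_comp:
  assumes "bij_aut M S" "bij_aut M T"
  shows "bij_aut M (S \<circ> T)"
proof (rule bij_autI)
  show "bij (S \<circ> T)" using assms bij_aut_bij bij_comp by blast
  show "(S \<circ> T) ` space M = space M"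
    by (simp only: image_comp[symmetric] bij_aut_image_space assms)
  show "(S \<circ> T) -` A \<inter> space M \<in> sets M" if "A \<in> sets M" for A
    using bij_aut_measurable[OF assms(1)] bij_aut_measurable[OF assms(2)] that
    by (intro measurable_sets[OF measurable_comp])
qed (simp_all only: image_comp[symmetric] bij_aut_image bij_aut_emeasure assms)

lemma bij_aut_funpow: "bij_aut M T \<Longrightarrow> bij_aut M (T ^^ n)"
proof (induction n)
  case (Suc n)
  then have "bij_aut M (T \<circ> T ^^ n)" by (intro bij_aut_comp)
  then show ?case by (simp only: funpow.simps)
qed (simp add: bij_aut_id)

lemma bij_aut_zpow: "bij_aut M T \<Longrightarrow> bij_aut M (zpow T k)"
  by (simp add: zpow_def bij_aut_funpow bij_aut_inv)

section \<open>Membership in full groups by pasting powers\<close>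

lemma full_group_paste:
  fixes A :: "nat \<Rightarrow> 'a set"
  assumes "full_group M G" "S \<in> Aut M" "range A \<subseteq> sets M" "disjoint_family A"
    "(\<Union>n. A n) = space M" "\<And>n. R n \<in> G" "\<And>n. AE x in M. x \<in> A n \<longrightarrow> S x = R n x"
  shows "S \<in> G"
proof -
  from assms(1) have "\<forall>S\<in>Aut M. \<forall>(A :: nat \<Rightarrow> 'a set) R.
        range A \<subseteq> sets M \<and> disjoint_family A \<and> (\<Union>n. A n) = space M \<and>
        (\<forall>n. R n \<in> G \<and> (AE x in M. x \<in> A n \<longrightarrow> S x = R n x)) \<longrightarrow> S \<in> G"
    unfolding full_group_def by (elim conjE) assumption
  from this[rule_format, OF assms(2), of A R] assms(3-) show ?thesis by simp
qed

lemma full_group_ae_eq: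
  assumes "full_group M G" "S \<in> Aut M" "R \<in> G" "AE x in M. S x = R x"
  shows "S \<in> G"
proof -
  define A where "A n = (if n = 0 then space M else {})" for n :: nat
  show ?thesis
    by (rule full_group_paste[OF assms(1,2), of A "\<lambda>_. R"])
      (use assms(3,4) in \<open>auto simp: A_def disjoint_family_on_def\<close>)
qed

lemma full_group_comp:
  "full_group M G \<Longrightarrow> S \<in> G \<Longrightarrow> T \<in> G \<Longrightarrow> S \<circ> T \<in> G"
  by (simp add: full_group_def)

text \<open>Full groups are closed under \<open>inv_into (space M)\<close>, which agrees with
  \<open>inv S\<close> on the space; closure under almost everywhere equality bridges the
  two.\<close>

lemma full_group_inv:
  assumes "full_group M G" "bij_aut M S" "S \<in> G"
  shows "inv S \<in> G"
proof (rule full_group_ae_eq[OF assms(1)])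
  show "inv S \<in> Aut M" using bij_aut_inv[OF assms(2)] by (simp add: bij_aut_def)
  show "inv_into (space M) S \<in> G" using assms by (simp add: full_group_def)
  have "inv S x = inv_into (space M) S x" if "x \<in> space M" for x
  proof -
    have "S (inv_into (space M) S x) = x"
      using that bij_aut_image_space[OF assms(2)] by (intro f_inv_into_f) simp
    then show ?thesis using bij_aut_bij[OF assms(2)] by (metis bij_is_inj inv_f_f)
  qed
  then show "AE x in M. inv S x = inv_into (space M) S x" by simp
qed

lemma full_group_zpow:
  assumes "full_group M G" "bij_aut M T" "T \<in> G"
  shows "zpow T k \<in> G"
proof -
  have pow: "S ^^ n \<in> G" if "S \<in> G" for S n
  proof (induction n)
    case 0
    then show ?case using assms(1) by (simp add: full_group_def id_def[symmetric])
  next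
    case (Suc n)
    then show ?case using full_group_comp[OF assms(1) that] by (simp only: funpow.simps)
  qed
  then show ?thesis using full_group_inv[OF assms] assms(3) by (simp add: zpow_def)
qed

text \<open>\<open>\<kappa>\<close> is the cocycle of \<open>S\<close> with respect to \<open>T\<close>, so \<open>S\<close> is pasted from countably many
  powers of \<open>T\<close>.\<close>

lemma bij_aut_cocycle:
  assumes T: "bij_aut M T" and S: "bij S"
    and k[measurable]: "\<kappa> \<in> measurable M (count_space UNIV)"
    and Sx: "\<And>x. x \<in> space M \<Longrightarrow> S x = zpow T (\<kappa> x) x"
    and Ssp: "S ` space M = space M"
  shows "bij_aut M S"
proof -
  define P where "P k = {x\<in>space M. \<kappa> x = k}" for k
  have P[measurable]: "P k \<in> sets M" for k unfolding P_def by measurable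
  note Tk = bij_aut_zpow[OF T]
  have SP: "S ` (A \<inter> P k) = zpow T k ` (A \<inter> P k)" for A k
    by (rule image_cong) (auto simp: P_def Sx)
  have im: "S ` A = (\<Union>k. S ` (A \<inter> P k))" if "A \<in> sets M" for A
    using sets.sets_into_space[OF that] by (auto simp: P_def)
  show ?thesis
  proof (rule bij_autI[OF S Ssp])
    fix A assume A[measurable]: "A \<in> sets M"
    have AP: "A \<inter> P k \<in> sets M" for k by measurable
    have SAP: "S ` (A \<inter> P k) \<in> sets M" for k
      unfolding SP by (intro bij_aut_image[OF Tk] AP)
    then show "S ` A \<in> sets M" unfolding im[OF A] by (intro sets.countable_UN'') auto
    have d: "disjoint_family (\<lambda>k. S ` (A \<inter> P k))"
      using S by (auto simp: disjoint_family_on_def P_def bij_def dest: injD)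
    have d': "disjoint_family (\<lambda>k. A \<inter> P k)" by (auto simp: disjoint_family_on_def P_def)
    have A': "A = (\<Union>k. A \<inter> P k)"
      using sets.sets_into_space[OF A] by (auto simp: P_def)
    have "emeasure M (S ` A) = (\<integral>\<^sup>+k. emeasure M (S ` (A \<inter> P k)) \<partial>count_space UNIV)"
      unfolding im[OF A] by (rule emeasure_UN_countable) (use SAP d in auto)
    also have "\<dots> = (\<integral>\<^sup>+k. emeasure M (A \<inter> P k) \<partial>count_space UNIV)"
      unfolding SP by (simp only: bij_aut_emeasure[OF Tk AP])
    also have "\<dots> = emeasure M (\<Union>k. A \<inter> P k)"
      by (rule emeasure_UN_countable[symmetric]) (use AP d' in auto)
    finally show "emeasure M (S ` A) = emeasure M A" using A' by simp
    have "S -` A \<inter> space M = (\<Union>k. P k \<inter> zpow T k -` A)"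
      by (auto simp: P_def Sx)
    also have "\<dots> \<in> sets M"
      using bij_aut_vimage[OF Tk A] by (intro sets.countable_UN'') auto
    finally show "S -` A \<inter> space M \<in> sets M" .
  qed
qed

lemma full_group_cocycle:
  assumes G: "full_group M G" and T: "bij_aut M T" "T \<in> G" and S: "bij S"
    and k[measurable]: "\<kappa> \<in> measurable M (count_space UNIV)"
    and Sx: "\<And>x. x \<in> space M \<Longrightarrow> S x = zpow T (\<kappa> x) x"
    and Ssp: "S ` space M = space M"
  shows "S \<in> G"
proof -
  define A where "A n = {x\<in>space M. \<kappa> x = int_decode n}" for n
  have [measurable]: "A n \<in> sets M" for n unfolding A_def by measurable
  show ?thesis
  proof (rule full_group_paste[OF G, of S A "\<lambda>n. zpow T (int_decode n)"])
    show "S \<in> Aut M"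
      using bij_aut_cocycle[OF T(1) S k Sx Ssp] by (simp add: bij_aut_def)
    show "disjoint_family A"
      by (auto simp: disjoint_family_on_def A_def dest: injD[OF inj_int_decode])
    show "(\<Union>n. A n) = space M"
    proof -
      have "x \<in> A (int_encode (\<kappa> x))" if "x \<in> space M" for x
        using that by (simp add: A_def int_encode_inverse)
      moreover have "A n \<subseteq> space M" for n by (auto simp: A_def)
      ultimately show ?thesis by blast
    qed
    show "AE x in M. x \<in> A n \<longrightarrow> S x = zpow T (int_decode n) x" for n
      by (rule AE_I2) (auto simp: A_def Sx)
  qed (use full_group_zpow[OF G T] in auto)
qed

text \<open>Making the values outside the space trivial turns an automorphism into a bijection of the
  whole type.\<close>

lemma Aut_bij_aut_extension:
  assumes "T \<in> Aut M"
  obtains T' where "bij_aut M T'" "\<And>x. x \<in> space M \<Longrightarrow> T' x = T x"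
    "\<And>G. full_group M G \<Longrightarrow> T \<in> G \<Longrightarrow> T' \<in> G"
proof -
  define T' where "T' x = (if x \<in> space M then T x else x)" for x
  have bb: "bij_betw T (space M) (space M)" using assms by (simp add: Aut_def)
  have "bij_betw T' (space M \<union> - space M) (space M \<union> - space M)"
  proof (rule bij_betw_combine)
    show "bij_betw T' (space M) (space M)"
      using bb by (rule bij_betw_cong[THEN iffD2, rotated]) (simp add: T'_def)
    show "bij_betw T' (- space M) (- space M)"
      by (rule bij_betw_cong[THEN iffD2, OF _ bij_betw_id]) (simp add: T'_def)
  qed auto
  then have bij: "bij T'" by simp
  have im: "T' ` A = T ` A" if "A \<in> sets M" for A
    using sets.sets_into_space[OF that] by (intro image_cong) (auto simp: T'_def)
  have "bij_aut M T'"
  proof (rule bij_autI[OF bij])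
    show "T' ` space M = space M" using im[of "space M"] bb by (simp add: bij_betw_def)
    show "T' ` A \<in> sets M" "emeasure M (T' ` A) = emeasure M A" if "A \<in> sets M" for A
      using assms that by (simp_all add: im Aut_def)
    show "T' -` A \<inter> space M \<in> sets M" if "A \<in> sets M" for A
    proof -
      have "T' -` A \<inter> space M = T -` A \<inter> space M" by (auto simp: T'_def)
      then show ?thesis using assms that by (auto simp: Aut_def intro: measurable_sets)
    qed
  qed
  moreover have "T' \<in> G" if "full_group M G" "T \<in> G" for G
    using that(1) \<open>bij_aut M T'\<close> that(2)
    by (intro full_group_ae_eq[of M G T' T]) (auto simp: bij_aut_def T'_def)
  ultimately show ?thesis using that by (auto simp: T'_def)
qed

section \<open>Transversals and invariant sets\<close>

text \<open>For bijective \<open>T\<close> this is the saturation of \<open>B\<close>, the least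
  \<open>T\<close>-invariant set containing it.\<close>

definition sat :: "('a \<Rightarrow> 'a) \<Rightarrow> 'a set \<Rightarrow> 'a set" where
  "sat T B = {x. \<exists>k. zpow T k x \<in> B}"

text \<open>A nonzero \<open>k\<close> may lead back to \<open>V\<close> if it leads back to the
  same point, so finite orbits can have transversals too.\<close>

definition partial_transversal :: "('a \<Rightarrow> 'a) \<Rightarrow> 'a set \<Rightarrow> bool" where
  "partial_transversal T V \<longleftrightarrow> (\<forall>x\<in>V. \<forall>k. zpow T k x \<in> V \<longrightarrow> zpow T k x = x)"

lemma satI: "zpow T k x \<in> B \<Longrightarrow> x \<in> sat T B"
  by (auto simp: sat_def)

lemma subset_sat: "B \<subseteq> sat T B"
  using satI[of T 0] by auto

lemma sat_Un: "sat T (A \<union> B) = sat T A \<union> sat T B"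
  by (auto simp: sat_def)

lemma sat_step:
  assumes "bij T"
  shows "T x \<in> sat T B \<longleftrightarrow> x \<in> sat T B"
proof -
  have "zpow T k (T x) = zpow T (k + 1) x" for k
    using zpow_add[OF assms, of k 1 x] by simp
  then have eq: "zpow T (k - 1) (T x) = zpow T k x" for k
    by simp
  show ?thesis
  proof
    assume "T x \<in> sat T B"
    then obtain k where "zpow T k (T x) \<in> B" by (auto simp: sat_def)
    then have "zpow T (k + 1) x \<in> B" using eq[of "k + 1"] by simp
    then show "x \<in> sat T B" by (rule satI)
  next
    assume "x \<in> sat T B"
    then obtain k where "zpow T k x \<in> B" by (auto simp: sat_def)
    then have "zpow T (k - 1) (T x) \<in> B" by (simp only: eq)
    then show "T x \<in> sat T B" by (rule satI)
  qed
qed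

lemma sat_zpow: "bij T \<Longrightarrow> zpow T k x \<in> sat T B \<longleftrightarrow> x \<in> sat T B"
  by (rule zpow_invariant[of T "\<lambda>x. x \<in> sat T B"]) (simp_all add: sat_step)

lemma sat_sets:
  assumes "bij_aut M T" "B \<in> sets M"
  shows "sat T B \<in> sets M"
proof -
  have "sat T B = (\<Union>k. zpow T k -` B)" by (auto simp: sat_def)
  also have "\<dots> \<in> sets M"
    using bij_aut_vimage[OF bij_aut_zpow[OF assms(1)] assms(2)] by (intro sets.countable_UN'') auto
  finally show ?thesis .
qed

lemma partial_transversalD:
  assumes "partial_transversal T V" "bij T" "zpow T i x \<in> V" "zpow T j x \<in> V"
  shows "zpow T i x = zpow T j x"
proof -
  have "zpow T (i - j) (zpow T j x) = zpow T i x"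
    using zpow_add[OF assms(2), of "i - j" j x] by simp
  then show ?thesis using assms by (metis partial_transversal_def)
qed

text \<open>The saturation of \<open>V\<close> consists of whole orbits, so what is kept of
  \<open>W\<close> lies on orbits that avoid \<open>V\<close>.\<close>

lemma partial_transversal_Un:
  assumes "bij T" "partial_transversal T V" "partial_transversal T W"
  shows "partial_transversal T (V \<union> (W - sat T V))"
    and "sat T (V \<union> (W - sat T V)) = sat T V \<union> sat T W"
proof -
  show "partial_transversal T (V \<union> (W - sat T V))"
    unfolding partial_transversal_def
  proof (intro ballI allI impI)
    fix x k assume x: "x \<in> V \<union> (W - sat T V)" "zpow T k x \<in> V \<union> (W - sat T V)"
    have "x \<in> sat T V \<longleftrightarrow> zpow T k x \<in> sat T V" using sat_zpow[OF assms(1)] by blast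
    then have "x \<in> V \<and> zpow T k x \<in> V \<or> x \<in> W \<and> zpow T k x \<in> W"
      using x subset_sat[of V T] by blast
    then show "zpow T k x = x"
      using assms(2,3) unfolding partial_transversal_def by blast
  qed
  show "sat T (V \<union> (W - sat T V)) = sat T V \<union> sat T W"
    using sat_zpow[OF assms(1)] by (auto simp: sat_Un) (auto simp: sat_def)
qed

text \<open>The sum counts the \<open>n\<close> with \<open>x\<close> in \<open>G n\<close>. Hence
  only countably many values occur, as \<open>halve_two_densities\<close> demands.\<close>

lemma suminf_indicator_nat_valued:
  fixes G :: "nat \<Rightarrow> 'a set"
  shows "(\<Sum>n. indicator (G n) x :: ennreal) \<in> insert \<infinity> (range of_nat)"
proof -
  have "(\<Sum>n. indicator (G n) x :: ennreal) = (\<Sum>n. indicator {n. x \<in> G n} n)"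
    by (simp add: indicator_def)
  also have "\<dots> = (\<integral>\<^sup>+n. indicator {n. x \<in> G n} n \<partial>count_space UNIV)"
    by (simp add: nn_integral_count_space_nat)
  also have "\<dots> = emeasure (count_space UNIV) {n. x \<in> G n}" by simp
  also have "\<dots> \<in> insert \<infinity> (range of_nat)"
    by (cases "finite {n. x \<in> G n}") (auto simp: emeasure_count_space)
  finally show ?thesis .
qed

text \<open>The density \<open>c\<close> counts the points of \<open>E\<close> on the orbit of a point of the transversal.\<close>

lemma emeasure_sat_density:
  assumes U: "bij_aut M U" and W: "W \<in> sets M" "partial_transversal U W" "space M \<subseteq> sat U W"
    and E: "E \<in> sets M"
  obtains c :: "'a \<Rightarrow> ennreal" where "c \<in> borel_measurable M" "range c \<subseteq> insert \<infinity> (range of_nat)"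
    "\<And>B. B \<in> sets M \<Longrightarrow> B \<subseteq> W \<Longrightarrow> emeasure M (E \<inter> sat U B) = (\<integral>\<^sup>+x. c x * indicator B x \<partial>M)"
proof -
  note bij = bij_aut_bij[OF U]
  define h where "h n = zpow U (int_decode n)" for n
  have hA: "bij_aut M (h n)" for n unfolding h_def by (rule bij_aut_zpow[OF U])
  \<comment> \<open>The first power in the enumeration that carries \<open>x\<close> into
    \<open>W\<close>. It assigns each point of \<open>E\<close> to exactly one \<open>P n\<close>,
    so \<open>c\<close> counts no point twice.\<close>
  define \<kappa> where "\<kappa> x = (LEAST n. h n x \<in> W)" for x
  have "Measurable.pred M (\<lambda>x. h n x \<in> W)" for n
  proof -
    have "{x \<in> space M. h n x \<in> W} = space M \<inter> h n -` W" by auto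
    then show ?thesis using bij_aut_vimage[OF hA W(1), of n] by (simp add: pred_def)
  qed
  then have [measurable]: "\<kappa> \<in> measurable M (count_space UNIV)"
    unfolding \<kappa>_def by (intro measurable_Least) auto
  define P where "P n = E \<inter> {x\<in>space M. \<kappa> x = n}" for n
  have P: "P n \<in> sets M" for n unfolding P_def using E by measurable
  define G where "G n = h n ` P n" for n
  have G[measurable]: "G n \<in> sets M" for n unfolding G_def by (intro bij_aut_image[OF hA] P)
  define c :: "'a \<Rightarrow> ennreal" where "c x = (\<Sum>n. indicator (G n) x)" for x
  show ?thesis
  proof
    show "c \<in> borel_measurable M" unfolding c_def by measurable
    show "range c \<subseteq> insert \<infinity> (range of_nat)"
      using suminf_indicator_nat_valued[of G] by (auto simp: c_def)
    fix B assume B[measurable]: "B \<in> sets M" and BW: "B \<subseteq> W"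
    have "E \<inter> sat U B = (\<Union>n. P n \<inter> h n -` B)"
    proof (intro equalityI subsetI)
      fix x assume "x \<in> E \<inter> sat U B"
      then obtain k where k: "x \<in> E" "zpow U k x \<in> B" by (auto simp: sat_def)
      then have x: "x \<in> space M" using sets.sets_into_space[OF E] by auto
      then obtain j where "zpow U j x \<in> W" using W(3) by (auto simp: sat_def)
      then have "h (int_encode j) x \<in> W" by (simp add: h_def int_encode_inverse)
      then have "h (\<kappa> x) x \<in> W" unfolding \<kappa>_def by (rule LeastI)
      \<comment> \<open>All powers of \<open>U\<close> that carry \<open>x\<close> into
        \<open>W\<close> carry it to the same point, so this one landing point decides whether the
        orbit meets \<open>B\<close>.\<close>
      then have "h (\<kappa> x) x = zpow U k x"
        using partial_transversalD[OF W(2) bij] k(2) BW unfolding h_def by blast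
      then show "x \<in> (\<Union>n. P n \<inter> h n -` B)"
        using k x by (auto simp: P_def)
    qed (auto simp: P_def h_def sat_def)
    then have "emeasure M (E \<inter> sat U B) = emeasure M (\<Union>n. P n \<inter> h n -` B)" by simp
    also have "\<dots> = (\<Sum>n. emeasure M (P n \<inter> h n -` B))"
      using P bij_aut_vimage[OF hA B]
      by (intro suminf_emeasure[symmetric]) (auto simp: disjoint_family_on_def P_def)
    also have "\<dots> = (\<Sum>n. emeasure M (G n \<inter> B))"
    proof (rule suminf_cong)
      fix n
      have "h n ` (P n \<inter> h n -` B) = G n \<inter> B" by (auto simp: G_def)
      then show "emeasure M (P n \<inter> h n -` B) = emeasure M (G n \<inter> B)"
        using bij_aut_emeasure[OF hA[of n], of "P n \<inter> h n -` B"] P bij_aut_vimage[OF hA B]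
        by simp
    qed
    also have "\<dots> = (\<Sum>n. \<integral>\<^sup>+x. indicator (G n) x * indicator B x \<partial>M)"
      by (simp add: indicator_inter_arith[symmetric])
    also have "\<dots> = (\<integral>\<^sup>+x. (\<Sum>n. indicator (G n) x * indicator B x) \<partial>M)"
      by (intro nn_integral_suminf[symmetric]) measurable
    also have "\<dots> = (\<integral>\<^sup>+x. c x * indicator B x \<partial>M)"
      by (simp add: c_def)
    finally show "emeasure M (E \<inter> sat U B) = (\<integral>\<^sup>+x. c x * indicator B x \<partial>M)" .
  qed
qed

text \<open>The saturation of any part of the transversal is invariant, and
  \<open>emeasure_sat_density\<close> turns the two required equalities into equalities of integrals
  over that part and over its complement in \<open>W\<close>.\<close>

lemma invariant_halving:
  fixes \<phi> :: "'a \<Rightarrow> real"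
  assumes U: "bij_aut M U" and W: "W \<in> sets M" "partial_transversal U W" "space M \<subseteq> sat U W"
    and E: "E\<^sub>1 \<in> sets M" "E\<^sub>2 \<in> sets M"
    and M: "atomless M" "\<phi> \<in> borel_measurable M" "inj_on \<phi> (space M)" "sigma_finite_measure M"
  obtains Y where "Y \<in> sets M" "\<And>x. U x \<in> Y \<longleftrightarrow> x \<in> Y"
    "emeasure M (E\<^sub>1 \<inter> Y) = emeasure M (E\<^sub>1 - Y)" "emeasure M (E\<^sub>2 \<inter> Y) = emeasure M (E\<^sub>2 - Y)"
proof -
  note bij = bij_aut_bij[OF U]
  obtain c\<^sub>1 :: "'a \<Rightarrow> ennreal" where c1: "c\<^sub>1 \<in> borel_measurable M" "range c\<^sub>1 \<subseteq> insert \<infinity> (range of_nat)"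
    "\<And>B. B \<in> sets M \<Longrightarrow> B \<subseteq> W \<Longrightarrow> emeasure M (E\<^sub>1 \<inter> sat U B) = (\<integral>\<^sup>+x. c\<^sub>1 x * indicator B x \<partial>M)"
    using emeasure_sat_density[OF U W E(1)] by blast
  obtain c\<^sub>2 :: "'a \<Rightarrow> ennreal" where c2: "c\<^sub>2 \<in> borel_measurable M" "range c\<^sub>2 \<subseteq> insert \<infinity> (range of_nat)"
    "\<And>B. B \<in> sets M \<Longrightarrow> B \<subseteq> W \<Longrightarrow> emeasure M (E\<^sub>2 \<inter> sat U B) = (\<integral>\<^sup>+x. c\<^sub>2 x * indicator B x \<partial>M)"
    using emeasure_sat_density[OF U W E(2)] by blast
  obtain Q where Q: "Q \<in> sets M" "Q \<subseteq> W"
    "(\<integral>\<^sup>+x. c\<^sub>1 x * indicator Q x \<partial>M) = (\<integral>\<^sup>+x. c\<^sub>1 x * indicator (W - Q) x \<partial>M)"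
    "(\<integral>\<^sup>+x. c\<^sub>2 x * indicator Q x \<partial>M) = (\<integral>\<^sup>+x. c\<^sub>2 x * indicator (W - Q) x \<partial>M)"
    by (rule halve_two_densities[OF M W(1) c1(1) c2(1) _ c1(2) c2(2)]) auto
  \<comment> \<open>Each orbit in the space meets the transversal in exactly one point, which lies
    either in \<open>Q\<close> or in \<open>W - Q\<close>.\<close>
  have compl: "E - sat U Q = E \<inter> sat U (W - Q)" if E: "E \<in> sets M" for E
  proof (intro equalityI subsetI)
    fix x assume x: "x \<in> E - sat U Q"
    then have "x \<in> sat U W" using sets.sets_into_space[OF E] W(3) by auto
    then obtain k where "zpow U k x \<in> W" by (auto simp: sat_def)
    then show "x \<in> E \<inter> sat U (W - Q)" using x by (auto simp: sat_def)
  next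
    fix x assume x: "x \<in> E \<inter> sat U (W - Q)"
    then obtain k where k: "zpow U k x \<in> W" "zpow U k x \<notin> Q" by (auto simp: sat_def)
    have "zpow U j x \<notin> Q" for j
      using partial_transversalD[OF W(2) bij k(1), of j] k(2) Q(2) by auto
    then show "x \<in> E - sat U Q" using x by (auto simp: sat_def)
  qed
  show ?thesis
  proof (rule that)
    show "sat U Q \<in> sets M" by (rule sat_sets[OF U Q(1)])
    show "U x \<in> sat U Q \<longleftrightarrow> x \<in> sat U Q" for x by (rule sat_step[OF bij])
  qed (use Q W(1) in \<open>simp_all add: compl E c1(3) c2(3)\<close>)
qed

section \<open>Small recurrent markers\<close>

lemma zpow_period:
  assumes "bij T" "zpow T m x = x"
  shows "zpow T k x = zpow T (k mod m) x"
proof -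
  have shift: "zpow T (i + m) x = zpow T i x" for i
    using zpow_add[OF assms(1), of i m x] assms(2) by simp
  have "zpow T (k mod m + q * m) x = zpow T (k mod m) x" for q
  proof (induction q rule: int_induct[where k = 0])
    case (step1 q)
    have "k mod m + (q + 1) * m = (k mod m + q * m) + m" by (simp add: algebra_simps)
    then show ?case using step1 shift[of "k mod m + q * m"] by (simp only:)
  next
    case (step2 q)
    have "k mod m + q * m = (k mod m + (q - 1) * m) + m" by (simp add: algebra_simps)
    then show ?case using step2 shift[of "k mod m + (q - 1) * m"] by (simp only:)
  qed simp
  from this[of "k div m"] show ?thesis by (simp add: mod_mult_div_eq mult.commute)
qed

text \<open>Of two such points on one orbit, the earlier would meet \<open>A\<close> again at the
  later one; in the backward version the later would meet \<open>A\<close> at the earlier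
  one.\<close>

lemma partial_transversal_no_return:
  assumes "bij T"
  shows "partial_transversal T {x\<in>A. \<forall>j>0. (T ^^ j) x \<notin> A}"
    and "partial_transversal T {x\<in>A. \<forall>j>0. zpow T (- int j) x \<notin> A}"
proof -
  have *: "k = 0" if "x \<in> A" "\<forall>j>0. (T ^^ j) x \<notin> A" "zpow T k x \<in> A"
    "\<forall>j>0. (T ^^ j) (zpow T k x) \<notin> A" for x k
  proof (rule ccontr)
    assume "k \<noteq> 0"
    then consider "k = int (nat k)" "nat k > 0" | "k = - int (nat (- k))" "nat (- k) > 0" by linarith
    then show False
    proof cases
      case 1
      then have "(T ^^ nat k) x \<in> A" using that(3) zpow_of_nat[of T "nat k" x] by simp
      then show ?thesis using that(2) 1 by blast
    next
      case 2
      then have "(T ^^ nat (- k)) (zpow T k x) = x"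
        using zpow_of_nat[of T "nat (- k)" "zpow T k x"] assms by simp
      then show ?thesis using that(1,4) 2 by metis
    qed
  qed
  have **: "k = 0" if "x \<in> A" "\<forall>j>0. zpow T (- int j) x \<notin> A" "zpow T k x \<in> A"
    "\<forall>j>0. zpow T (- int j) (zpow T k x) \<notin> A" for x k
  proof (rule ccontr)
    assume "k \<noteq> 0"
    then consider "k = int (nat k)" "nat k > 0" | "k = - int (nat (- k))" "nat (- k) > 0" by linarith
    then show False
    proof cases
      case 1
      then have "zpow T (- int (nat k)) (zpow T k x) = x" using assms by simp
      then show ?thesis using that(1,4) 1 by metis
    next
      case 2
      then show ?thesis using that(2,3) by metis
    qed
  qed
  show "partial_transversal T {x\<in>A. \<forall>j>0. (T ^^ j) x \<notin> A}"
    unfolding partial_transversal_def using * by (metis (no_types, lifting) mem_Collect_eq zpow_0)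
  show "partial_transversal T {x\<in>A. \<forall>j>0. zpow T (- int j) x \<notin> A}"
    unfolding partial_transversal_def using ** by (metis (no_types, lifting) mem_Collect_eq zpow_0)
qed

section \<open>Infima of a nonnegative function along orbits\<close>

definition orbit_inf :: "('a \<Rightarrow> 'a) \<Rightarrow> ('a \<Rightarrow> real) \<Rightarrow> 'a \<Rightarrow> real" where
  "orbit_inf T \<phi> x = (INF k. \<phi> (zpow T k x))"

lemma orbit_inf_step:
  assumes "bij T"
  shows "orbit_inf T \<phi> (T x) = orbit_inf T \<phi> x"
proof -
  have eq: "zpow T k (T x) = zpow T (k + 1) x" for k
    using zpow_add[OF assms, of k 1 x] by simp
  have "range (\<lambda>k. \<phi> (zpow T k (T x))) = range ((\<lambda>k. \<phi> (zpow T k x)) \<circ> (\<lambda>k. k + 1))"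
    by (simp add: eq comp_def)
  also have "\<dots> = range (\<lambda>k. \<phi> (zpow T k x))"
    unfolding image_comp[symmetric] by (simp add: surj_plus_right)
  finally show ?thesis by (simp add: orbit_inf_def)
qed

lemma orbit_inf_zpow: "bij T \<Longrightarrow> orbit_inf T \<phi> (zpow T k x) = orbit_inf T \<phi> x"
  by (rule zpow_invariant) (simp_all add: orbit_inf_step)

context
  fixes \<phi> :: "'a \<Rightarrow> real" and T :: "'a \<Rightarrow> 'a"
  assumes nonneg: "\<And>x. 0 \<le> \<phi> x"
begin

lemma orbit_bdd_below: "bdd_below (range (\<lambda>k. \<phi> (zpow T k x)))"
  using nonneg by (intro bdd_belowI[of _ 0]) auto

lemma orbit_inf_le: "orbit_inf T \<phi> x \<le> \<phi> x"
  using cINF_lower[OF orbit_bdd_below, of 0 x] by (simp add: orbit_inf_def)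

lemma orbit_inf_nonneg: "0 \<le> orbit_inf T \<phi> x"
  unfolding orbit_inf_def by (rule cINF_greatest) (auto simp: nonneg)

lemma orbit_inf_approx: "orbit_inf T \<phi> x < t \<Longrightarrow> \<exists>k. \<phi> (zpow T k x) < t"
  using cINF_less_iff[OF _ orbit_bdd_below, of x t] by (simp add: orbit_inf_def)

text \<open>A periodic orbit is finite, so its infimum is a minimum. This puts periodic orbits into
  the saturation of \<open>W\<close> and keeps them out of the marker set.\<close>

lemma orbit_inf_attained_if_periodic:
  assumes "bij T" "m > 0" "(T ^^ m) x = x"
  shows "\<exists>k. \<phi> (zpow T k x) = orbit_inf T \<phi> x"
proof -
  have "zpow T (int m) x = x" using assms(3) by (simp add: zpow_of_nat)
  then have "range (\<lambda>k. \<phi> (zpow T k x)) \<subseteq> (\<lambda>k. \<phi> (zpow T k x)) ` {0..<int m}"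
  proof (intro image_subsetI)
    fix k
    have "zpow T k x = zpow T (k mod int m) x"
      by (rule zpow_period[OF assms(1) \<open>zpow T (int m) x = x\<close>])
    moreover have "k mod int m \<in> {0..<int m}" using assms(2) by simp
    ultimately show "\<phi> (zpow T k x) \<in> (\<lambda>k. \<phi> (zpow T k x)) ` {0..<int m}"
      by (metis imageI)
  qed
  then have fin: "finite (range (\<lambda>k. \<phi> (zpow T k x)))" by (rule finite_subset) simp
  have "orbit_inf T \<phi> x \<in> range (\<lambda>k. \<phi> (zpow T k x))"
    unfolding orbit_inf_def using fin by (subst cInf_eq_Min) (auto intro!: Min_in)
  then show ?thesis by auto
qed

end

lemma orbit_inf_measurable:
  fixes \<phi> :: "'a \<Rightarrow> real"
  assumes "bij_aut M T" "\<phi> \<in> borel_measurable M" "\<And>x. 0 \<le> \<phi> x"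
  shows "orbit_inf T \<phi> \<in> borel_measurable M"
  unfolding orbit_inf_def
proof (rule borel_measurable_cINF)
  show "(\<lambda>x. \<phi> (zpow T k x)) \<in> borel_measurable M" for k
    using measurable_compose[OF bij_aut_measurable[OF bij_aut_zpow[OF assms(1)]] assms(2)] .
  show "bdd_below ((\<lambda>k. \<phi> (zpow T k x)) ` UNIV)" for x
    by (rule orbit_bdd_below[OF assms(3)])
qed simp

text \<open>Points nearly minimising \<open>\<phi>\<close> on their orbit form sets that decrease, as the tolerance
  shrinks, to the set where the infimum is attained; this set is a partial transversal, so off its
  saturation the markers become small. The tolerance may depend on the integer part of the
  infimum, which keeps everything inside sets of finite measure.\<close>

lemma small_near_minimal_set:
  fixes \<phi> :: "'a \<Rightarrow> real"
  assumes T: "bij_aut M T"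
    and phi[measurable]: "\<phi> \<in> borel_measurable M" and inj: "inj_on \<phi> (space M)"
    and nonneg: "\<And>x. 0 \<le> \<phi> x" and fin: "\<And>t. emeasure M {x\<in>space M. \<phi> x < t} < \<infinity>"
    and eps: "\<epsilon> > 0"
  obtains A W where "A \<in> sets M" "W \<in> sets M" "emeasure M A < ennreal \<epsilon>"
    "partial_transversal T W" "space M \<subseteq> sat T W \<union> sat T A"
    "\<And>x m. x \<in> space M \<Longrightarrow> m > 0 \<Longrightarrow> (T ^^ m) x = x \<Longrightarrow> x \<in> sat T W"
proof -
  note bij = bij_aut_bij[OF T]
  let ?f = "orbit_inf T \<phi>"
  have [measurable]: "?f \<in> borel_measurable M" by (rule orbit_inf_measurable[OF T phi nonneg])
  \<comment> \<open>An orbit in the space has at most one minimiser, since \<open>\<phi>\<close> is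
    injective there.\<close>
  define W where "W = {x\<in>space M. \<phi> x = ?f x}"
  have [measurable]: "W \<in> sets M" unfolding W_def by measurable
  have sW[measurable]: "sat T W \<in> sets M" by (rule sat_sets[OF T \<open>W \<in> sets M\<close>])
  \<comment> \<open>\<open>k\<close> is the integer part of the infimum. The tolerance is at most 1,
    so \<open>\<phi>\<close> stays below \<open>k + 2\<close> on this set; its measure is therefore
    finite, as continuity from above requires.\<close>
  define A where "A k m = {x\<in>space M - sat T W. real k \<le> ?f x \<and> ?f x < real k + 1 \<and>
    \<phi> x < ?f x + 1 / Suc m}" for k m
  have A[measurable]: "A k m \<in> sets M" for k m
  proof -
    have "A k m = {x\<in>space M. real k \<le> ?f x \<and> ?f x < real k + 1 \<and> \<phi> x < ?f x + 1 / Suc m} - sat T W"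
      by (auto simp: A_def)
    then show ?thesis by simp
  qed
  \<comment> \<open>These bounds sum to \<epsilon>/2, which restores the strict inequality lost in
    passing to the countable sum.\<close>
  have small: "\<exists>m. emeasure M (A k m) < ennreal (\<epsilon> * (1/2)^(k+2))" for k
  proof -
    have dec: "decseq (A k)"
    proof (rule decseq_SucI)
      fix m
      have "1 / real (Suc (Suc m)) \<le> 1 / real (Suc m)" by (intro divide_left_mono) auto
      then show "A k (Suc m) \<subseteq> A k m" unfolding A_def by auto
    qed
    have "emeasure M (A k m) \<noteq> \<infinity>" for m
    proof -
      have "A k m \<subseteq> {x\<in>space M. \<phi> x < real k + 2}"
      proof
        fix x assume x: "x \<in> A k m"
        have "1 / real (Suc m) \<le> 1" by simp
        moreover have "\<phi> x < ?f x + 1 / real (Suc m)" "?f x < real k + 1" "x \<in> space M"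
          using x by (simp_all add: A_def del: of_nat_Suc)
        ultimately have "\<phi> x < real k + 2" by linarith
        with \<open>x \<in> space M\<close> show "x \<in> {x\<in>space M. \<phi> x < real k + 2}" by simp
      qed
      then have "emeasure M (A k m) \<le> emeasure M {x\<in>space M. \<phi> x < real k + 2}"
        by (rule emeasure_mono) measurable
      then show ?thesis using fin[of "real k + 2"] by (auto simp: top_unique)
    qed
    then have "(\<lambda>m. emeasure M (A k m)) \<longlonglongrightarrow> emeasure M (\<Inter>m. A k m)"
      using A by (intro Lim_emeasure_decseq[OF _ dec]) auto
    also have "(\<Inter>m. A k m) = {}"
    proof (rule equals0I)
      fix x assume x: "x \<in> (\<Inter>m. A k m)"
      have "\<phi> x \<le> ?f x"
      proof (rule field_le_epsilon)
        fix e :: real assume "e > 0"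
        then obtain m where "1 / real (Suc m) < e" using nat_approx_posE by blast
        moreover have "\<phi> x < ?f x + 1 / Suc m" using x by (auto simp: A_def)
        ultimately show "\<phi> x \<le> ?f x + e" by linarith
      qed
      moreover have "?f x \<le> \<phi> x" by (rule orbit_inf_le[OF nonneg])
      ultimately have "x \<in> W" using x by (auto simp: A_def W_def)
      then show False using x subset_sat[of W T] by (auto simp: A_def)
    qed
    finally have "(\<lambda>m. emeasure M (A k m)) \<longlonglongrightarrow> 0" by simp
    moreover have "0 < ennreal (\<epsilon> * (1/2)^(k+2))" using eps by simp
    ultimately have "eventually (\<lambda>m. emeasure M (A k m) < ennreal (\<epsilon> * (1/2)^(k+2))) sequentially"
      by (rule order_tendstoD(2))
    then show ?thesis by (auto simp: eventually_sequentially)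
  qed
  then obtain m where m: "\<And>k. emeasure M (A k (m k)) < ennreal (\<epsilon> * (1/2)^(k+2))" by metis
  show ?thesis
  proof
    show "(\<Union>k. A k (m k)) \<in> sets M" by measurable
    show "W \<in> sets M" by fact
    have sums: "(\<lambda>k. \<epsilon> * (1/2)^(k+2)) sums (\<epsilon> / 2)"
    proof -
      have "(\<lambda>k. (\<epsilon> / 4) * (1/2)^k) sums ((\<epsilon> / 4) * (1 / (1 - 1/2)))"
        by (intro sums_mult geometric_sums) simp
      then show ?thesis by (simp add: power_add field_simps)
    qed
    have "emeasure M (\<Union>k. A k (m k)) \<le> (\<Sum>k. emeasure M (A k (m k)))"
      by (rule emeasure_subadditive_countably) auto
    also have "\<dots> \<le> (\<Sum>k. ennreal (\<epsilon> * (1/2)^(k+2)))"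
      by (intro suminf_le less_imp_le[OF m]) auto
    also have "\<dots> = ennreal (\<epsilon> / 2)"
      using sums eps by (subst suminf_ennreal2) (auto simp: sums_iff)
    also have "\<dots> < ennreal \<epsilon>" using eps by (simp add: ennreal_less_iff)
    finally show "emeasure M (\<Union>k. A k (m k)) < ennreal \<epsilon>" .
    show "partial_transversal T W"
      unfolding partial_transversal_def
    proof (intro ballI allI impI)
      fix x k assume x: "x \<in> W" "zpow T k x \<in> W"
      then have "\<phi> (zpow T k x) = \<phi> x" by (simp add: W_def orbit_inf_zpow[OF bij])
      then show "zpow T k x = x" using x by (intro inj_onD[OF inj]) (auto simp: W_def)
    qed
    show "space M \<subseteq> sat T W \<union> sat T (\<Union>k. A k (m k))"
    proof
      fix x assume x: "x \<in> space M"
      show "x \<in> sat T W \<union> sat T (\<Union>k. A k (m k))"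
      proof (cases "x \<in> sat T W")
        case False
        define k where "k = nat \<lfloor>?f x\<rfloor>"
        have k: "real k \<le> ?f x" "?f x < real k + 1"
          using orbit_inf_nonneg[where \<phi> = \<phi> and T = T and x = x, OF nonneg] unfolding k_def by linarith+
        have "?f x < ?f x + 1 / Suc (m k)" by simp
        then obtain j where j: "\<phi> (zpow T j x) < ?f x + 1 / Suc (m k)"
          using orbit_inf_approx[where \<phi> = \<phi>, OF nonneg] by blast
        have "zpow T j x \<in> A k (m k)"
          using j k x False bij_aut_space_iff[OF bij_aut_zpow[OF T]]
          by (simp add: A_def orbit_inf_zpow[OF bij] sat_zpow[OF bij])
        then have "x \<in> sat T (\<Union>k. A k (m k))" by (intro satI[of _ j]) auto
        then show ?thesis by simp
      qed simp
    qed
    show "x \<in> sat T W" if x: "x \<in> space M" "n > 0" "(T ^^ n) x = x" for x n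
    proof -
      obtain k where "\<phi> (zpow T k x) = ?f x"
        using orbit_inf_attained_if_periodic[where \<phi> = \<phi>, OF nonneg bij x(2,3)] by blast
      then have "zpow T k x \<in> W"
        using x(1) bij_aut_space_iff[OF bij_aut_zpow[OF T]] by (simp add: W_def orbit_inf_zpow[OF bij])
      then show ?thesis by (rule satI)
    qed
  qed
qed

text \<open>Points of \<open>A\<close> without a later visit to \<open>A\<close>, or without an
  earlier one, form partial transversals, so their orbits can be handed over to \<open>W\<close>.
  Only whole orbits are removed, hence the visits that make the other points recurrent
  survive.\<close>

lemma recurrent_markers:
  fixes \<phi> :: "'a \<Rightarrow> real"
  assumes T: "bij_aut M T"
    and "\<phi> \<in> borel_measurable M" "inj_on \<phi> (space M)"
    "\<And>x. 0 \<le> \<phi> x" "\<And>t. emeasure M {x\<in>space M. \<phi> x < t} < \<infinity>" "\<epsilon> > 0"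
  obtains A W where "A \<in> sets M" "W \<in> sets M" "emeasure M A < ennreal \<epsilon>"
    "partial_transversal T W" "A \<inter> sat T W = {}" "space M \<subseteq> sat T W \<union> sat T A"
    "\<And>x. x \<in> A \<Longrightarrow> \<exists>j>0. (T ^^ j) x \<in> A"
    "\<And>x. x \<in> A \<Longrightarrow> \<exists>j>0. zpow T (- int j) x \<in> A"
    "\<And>x m. x \<in> A \<Longrightarrow> m > 0 \<Longrightarrow> (T ^^ m) x \<noteq> x"
proof -
  note bij = bij_aut_bij[OF T]
  obtain A W where A[measurable]: "A \<in> sets M" and W[measurable]: "W \<in> sets M"
    and small: "emeasure M A < ennreal \<epsilon>"
    and tr: "partial_transversal T W" and cover: "space M \<subseteq> sat T W \<union> sat T A"
    and per: "\<And>x m. x \<in> space M \<Longrightarrow> m > 0 \<Longrightarrow> (T ^^ m) x = x \<Longrightarrow> x \<in> sat T W"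
    using small_near_minimal_set[OF assms] by blast
  define F where "F = {x\<in>A. \<forall>j>0. (T ^^ j) x \<notin> A}"
  define B where "B = {x\<in>A. \<forall>j>0. zpow T (- int j) x \<notin> A}"
  have pre: "zpow T k -` A \<in> sets M" for k
    by (rule bij_aut_vimage[OF bij_aut_zpow[OF T] A])
  have "F = A - (\<Union>j\<in>{0<..}. zpow T (int j) -` A)"
    by (auto simp: F_def zpow_of_nat)
  then have [measurable]: "F \<in> sets M"
    using pre by (auto intro!: sets.countable_UN' sets.Diff)
  have "B = A - (\<Union>j\<in>{0<..}. zpow T (- int j) -` A)"
    by (auto simp: B_def)
  then have [measurable]: "B \<in> sets M"
    using pre by (auto intro!: sets.countable_UN' sets.Diff)
  define W1 where "W1 = W \<union> (F - sat T W)"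
  have W1: "W1 \<in> sets M" "partial_transversal T W1" "sat T W1 = sat T W \<union> sat T F"
    using partial_transversal_Un[OF bij tr, of F] partial_transversal_no_return(1)[OF bij, of A]
      sat_sets[OF T W] by (simp_all add: W1_def F_def[symmetric])
  define W2 where "W2 = W1 \<union> (B - sat T W1)"
  have W2: "W2 \<in> sets M" "partial_transversal T W2" "sat T W2 = sat T W \<union> sat T F \<union> sat T B"
    using partial_transversal_Un[OF bij W1(2), of B] partial_transversal_no_return(2)[OF bij, of A]
      sat_sets[OF T W1(1)] W1(1,3) by (simp_all add: W2_def B_def[symmetric])
  define A' where "A' = A - sat T W2"
  have memA: "zpow T k x \<in> A'" if "zpow T k x \<in> A" "x \<notin> sat T W2" for x k
    using that sat_zpow[OF bij] by (auto simp: A'_def)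
  show ?thesis
  proof (rule that[of A' W2])
    show "A' \<in> sets M" using sat_sets[OF T W2(1)] by (simp add: A'_def)
    have "emeasure M A' \<le> emeasure M A" by (rule emeasure_mono) (auto simp: A'_def)
    then show "emeasure M A' < ennreal \<epsilon>" using small by simp
    show "A' \<inter> sat T W2 = {}" by (auto simp: A'_def)
    show "space M \<subseteq> sat T W2 \<union> sat T A'"
    proof
      fix x assume "x \<in> space M"
      then have "x \<in> sat T W2 \<or> (x \<notin> sat T W2 \<and> x \<in> sat T A)" using cover W2(3) by auto
      then show "x \<in> sat T W2 \<union> sat T A'" using memA by (auto simp: sat_def)
    qed
    fix x assume x: "x \<in> A'"
    then have "x \<notin> sat T F" "x \<notin> sat T B" "x \<notin> sat T W2" "x \<in> A"
      using W2(3) by (auto simp: A'_def)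
    moreover then have "x \<notin> F" "x \<notin> B"
      using subset_sat[of F T] subset_sat[of B T] by auto
    ultimately obtain i j where ij: "i > 0" "zpow T (int i) x \<in> A" "j > 0" "zpow T (- int j) x \<in> A"
      by (auto simp: F_def B_def zpow_of_nat)
    show "\<exists>j>0. (T ^^ j) x \<in> A'" "\<exists>j>0. zpow T (- int j) x \<in> A'"
      using ij memA \<open>x \<notin> sat T W2\<close> zpow_of_nat by metis+
    have "x \<in> space M" using \<open>x \<in> A\<close> sets.sets_into_space[OF A] by auto
    then show "(T ^^ m) x \<noteq> x" if "m > 0" for m
      using per[OF _ that] \<open>x \<notin> sat T W2\<close> W2(3) by auto
  qed (use W2 in auto)
qed

section \<open>First return maps\<close>

lemma funpow_inj:
  fixes T :: "'a \<Rightarrow> 'a"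
  shows "bij T \<Longrightarrow> (T ^^ n) x = (T ^^ n) y \<longleftrightarrow> x = y"
  using inj_fn[of T n] by (auto simp: bij_is_inj inj_eq)

definition first_return :: "('a \<Rightarrow> 'a) \<Rightarrow> 'a set \<Rightarrow> 'a \<Rightarrow> nat" where
  "first_return T A x = (LEAST j. 0 < j \<and> (T ^^ j) x \<in> A)"

definition induced_map :: "('a \<Rightarrow> 'a) \<Rightarrow> 'a set \<Rightarrow> 'a \<Rightarrow> 'a" where
  "induced_map T A x = (if x \<in> A then (T ^^ first_return T A x) x else x)"

text \<open>The first point of \<open>A\<close> on the forward orbit is an invariant of \<open>T \<circ> inv (induced_map T A)\<close>:
  that map runs up the tower over \<open>A\<close> and then falls back to its start.\<close>

definition entry_point :: "('a \<Rightarrow> 'a) \<Rightarrow> 'a set \<Rightarrow> 'a \<Rightarrow> 'a" where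
  "entry_point T A x = (T ^^ (LEAST j. (T ^^ j) x \<in> A)) x"

lemma entry_point_mem: "x \<in> A \<Longrightarrow> entry_point T A x = x"
  unfolding entry_point_def by (subst Least_eq_0) auto

lemma entry_point_not_mem:
  assumes "x \<notin> A" "(T ^^ n) x \<in> A"
  shows "entry_point T A (T x) = entry_point T A x"
proof -
  have "(LEAST j. (T ^^ j) x \<in> A) = Suc (LEAST j. (T ^^ Suc j) x \<in> A)"
    using assms by (intro Least_Suc[of _ n]) auto
  then show ?thesis by (simp add: entry_point_def funpow_swap1)
qed

context
  fixes T :: "'a \<Rightarrow> 'a" and A :: "'a set"
  assumes bij: "bij T"
    and forward: "\<And>x. x \<in> A \<Longrightarrow> \<exists>j>0. (T ^^ j) x \<in> A"
    and backward: "\<And>x. x \<in> A \<Longrightarrow> \<exists>j>0. zpow T (- int j) x \<in> A"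
begin

lemma first_return_works:
  "x \<in> A \<Longrightarrow> 0 < first_return T A x \<and> (T ^^ first_return T A x) x \<in> A"
  unfolding first_return_def by (rule LeastI_ex) (rule forward)

lemma first_return_least: "0 < j \<Longrightarrow> (T ^^ j) x \<in> A \<Longrightarrow> first_return T A x \<le> j"
  unfolding first_return_def by (rule Least_le) simp

lemma induced_map_mem_iff: "induced_map T A x \<in> A \<longleftrightarrow> x \<in> A"
  using first_return_works by (auto simp: induced_map_def)

text \<open>Searching from \<open>T x\<close> at time 0 on is searching from \<open>x\<close> at
  time 1 on, which finds the first return.\<close>

lemma entry_point_image_mem:
  assumes "x \<in> A"
  shows "entry_point T A (T x) = induced_map T A x"
proof -
  have "first_return T A x = Suc (LEAST j. 0 < Suc j \<and> (T ^^ Suc j) x \<in> A)"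
    unfolding first_return_def using first_return_works[OF assms] by (intro Least_Suc) auto
  then show ?thesis using assms by (simp add: entry_point_def induced_map_def funpow_swap1)
qed

text \<open>If the return times differed, \<open>x\<close> would be a visit of the orbit of
  \<open>y\<close> to \<open>A\<close> at time \<open>d\<close>, earlier than the first return of
  \<open>y\<close>.\<close>

lemma induced_map_inj_aux:
  assumes "x \<in> A" "y \<in> A" "induced_map T A x = induced_map T A y"
    "first_return T A x \<le> first_return T A y"
  shows "x = y"
proof -
  define d where "d = first_return T A y - first_return T A x"
  have "first_return T A y = first_return T A x + d" using assms(4) by (simp add: d_def)
  then have "(T ^^ first_return T A x) x = (T ^^ first_return T A x) ((T ^^ d) y)"
    using assms(1-3) by (simp add: induced_map_def funpow_add)
  then have x: "x = (T ^^ d) y" using funpow_inj[OF bij] by blast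
  have "d = 0"
  proof (rule ccontr)
    assume "d \<noteq> 0"
    then have "first_return T A y \<le> d" using x assms(1) by (intro first_return_least) auto
    then show False using first_return_works[OF assms(1)] assms(4) by (auto simp: d_def)
  qed
  then show ?thesis using x by simp
qed

lemma bij_induced_map: "bij (induced_map T A)"
proof (rule bijI)
  show "inj (induced_map T A)"
  proof (rule injI)
    fix x y assume eq: "induced_map T A x = induced_map T A y"
    then have "x \<in> A \<longleftrightarrow> y \<in> A" using induced_map_mem_iff by metis
    then consider "x \<in> A" "y \<in> A" | "x \<notin> A" "y \<notin> A" by blast
    then show "x = y"
    proof cases
      case 1
      then show ?thesis
        using induced_map_inj_aux[of x y] induced_map_inj_aux[of y x] eq by (metis nat_le_linear)
    next
      case 2
      then show ?thesis using eq by (simp add: induced_map_def)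
    qed
  qed
  show "surj (induced_map T A)"
    unfolding surj_def
  proof
    fix y
    have "\<exists>x. induced_map T A x = y"
    proof (cases "y \<in> A")
      case True
      \<comment> \<open>The preimage of \<open>y\<close> is its most recent earlier visit to
        \<open>A\<close>; minimality of \<open>i\<close> rules out visits in between, so the first
        return of \<open>x\<close> takes exactly \<open>i\<close> steps.\<close>
      define i where "i = (LEAST j. 0 < j \<and> zpow T (- int j) y \<in> A)"
      have i: "0 < i" "zpow T (- int i) y \<in> A"
        using LeastI_ex[OF backward[OF True]] by (auto simp: i_def)
      define x where "x = zpow T (- int i) y"
      have Tx: "(T ^^ j) x = zpow T (int j - int i) y" for j
        using zpow_add[OF bij, of "int j" "- int i" y] by (simp add: x_def zpow_of_nat)
      have "first_return T A x = i"
        unfolding first_return_def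
      proof (rule Least_equality)
        show "0 < i \<and> (T ^^ i) x \<in> A" using i True Tx by simp
        fix j assume j: "0 < j \<and> (T ^^ j) x \<in> A"
        show "i \<le> j"
        proof (rule ccontr)
          assume "\<not> i \<le> j"
          then have "int j - int i = - int (i - j)" "0 < i - j" by auto
          then have "i \<le> i - j" using j Tx[of j] unfolding i_def by (intro Least_le) simp
          then show False using j i(1) by linarith
        qed
      qed
      then have "induced_map T A x = y" using i(2) Tx by (simp add: induced_map_def x_def)
      then show ?thesis ..
    next
      case False
      then show ?thesis by (intro exI[of _ y]) (simp add: induced_map_def)
    qed
    then show "\<exists>x. y = induced_map T A x" by metis
  qed
qed

lemma inv_induced_map:
  "x \<notin> A \<Longrightarrow> inv (induced_map T A) x = x"
  "x \<in> A \<Longrightarrow> inv (induced_map T A) x \<in> A"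
proof -
  show "inv (induced_map T A) x = x" if "x \<notin> A"
    using that bij_induced_map by (intro inv_f_eq) (auto simp: bij_is_inj induced_map_def)
  show "inv (induced_map T A) x \<in> A" if "x \<in> A"
    using that induced_map_mem_iff bij_induced_map by (metis bij_is_surj surj_f_inv_f)
qed

text \<open>Return times add up, so iterates of the induced map are positive powers of
  \<open>T\<close>; this is how absence of periodic points passes to the induced map.\<close>

lemma funpow_induced_map:
  assumes "x \<in> A" "0 < n"
  shows "(induced_map T A ^^ n) x \<in> A" and "\<exists>m>0. (induced_map T A ^^ n) x = (T ^^ m) x"
proof -
  have "(induced_map T A ^^ n) x \<in> A \<and> (\<exists>m>0. (induced_map T A ^^ n) x = (T ^^ m) x)"
    using assms(2)
  proof (induction n rule: nat_induct_non_zero)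
    case 1
    then show ?case using assms(1) first_return_works induced_map_mem_iff
      by (auto simp: induced_map_def)
  next
    case (Suc n)
    define y where "y = (induced_map T A ^^ n) x"
    obtain m where m: "m > 0" "y = (T ^^ m) x" and yA: "y \<in> A"
      using Suc by (auto simp: y_def)
    have "(induced_map T A ^^ Suc n) x = (T ^^ first_return T A y) y"
      using yA by (simp add: y_def[symmetric] induced_map_def)
    also have "\<dots> = (T ^^ (first_return T A y + m)) x" using m(2) by (simp add: funpow_add)
    finally show ?case using m(1) yA induced_map_mem_iff[of y] by (auto simp: y_def)
  qed
  then show "(induced_map T A ^^ n) x \<in> A" "\<exists>m>0. (induced_map T A ^^ n) x = (T ^^ m) x"
    by auto
qed

lemma induced_map_aperiodic:
  assumes "\<And>x m. x \<in> A \<Longrightarrow> m > 0 \<Longrightarrow> (T ^^ m) x \<noteq> x" "x \<in> A"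
  shows "inj (\<lambda>n. (induced_map T A ^^ n) x)"
proof (rule linorder_injI)
  fix i j :: nat assume "i < j"
  then have "(induced_map T A ^^ j) x = (induced_map T A ^^ i) ((induced_map T A ^^ (j - i)) x)"
    using funpow_add[of i "j - i" "induced_map T A"] by simp
  moreover have "(induced_map T A ^^ (j - i)) x \<noteq> x"
    using funpow_induced_map(2)[OF assms(2), of "j - i"] assms(1)[OF assms(2)] \<open>i < j\<close> by fastforce
  ultimately show "(induced_map T A ^^ i) x \<noteq> (induced_map T A ^^ j) x"
    using funpow_inj[OF bij_induced_map] by metis
qed

text \<open>Each visit to \<open>A\<close> is followed by a later one, so visits occur beyond any
  time bound, in particular at a nonnegative time.\<close>

lemma sat_forward:
  assumes "x \<in> sat T A"
  shows "\<exists>n. (T ^^ n) x \<in> A"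
proof -
  obtain k where k: "zpow T k x \<in> A" using assms by (auto simp: sat_def)
  have "\<exists>j \<ge> k + int n. zpow T j x \<in> A" for n
  proof (induction n)
    case 0
    then show ?case using k by auto
  next
    case (Suc n)
    then obtain j where j: "j \<ge> k + int n" "zpow T j x \<in> A" by blast
    then obtain i where i: "i > 0" "(T ^^ i) (zpow T j x) \<in> A" using forward by blast
    then have "zpow T (int i + j) x \<in> A"
      using zpow_add[OF bij, of "int i" j x] by (simp add: zpow_of_nat)
    then show ?case using i(1) j(1) by (intro exI[of _ "int i + j"]) auto
  qed
  from this[of "nat (- k)"] obtain j where "j \<ge> k + int (nat (- k))" "zpow T j x \<in> A" by blast
  moreover then have "j \<ge> 0" by linarith
  ultimately have "(T ^^ nat j) x \<in> A" using zpow_of_nat[of T "nat j" x] by simp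
  then show ?thesis ..
qed

abbreviation "tower_map \<equiv> T \<circ> inv (induced_map T A)"

lemma bij_tower_map: "bij tower_map"
  using bij bij_induced_map by (intro bij_comp bij_imp_bij_inv)

lemma sat_tower_map: "tower_map x \<in> sat T A \<longleftrightarrow> x \<in> sat T A"
proof (cases "x \<in> A")
  case True
  then show ?thesis
    using inv_induced_map(2)[OF True] subset_sat[of A T] sat_step[OF bij] by auto
next
  case False
  then show ?thesis using inv_induced_map(1) sat_step[OF bij] by simp
qed

lemma entry_point_tower_map:
  assumes "x \<in> sat T A"
  shows "entry_point T A (tower_map x) = entry_point T A x"
proof (cases "x \<in> A")
  case True
  \<comment> \<open>With \<open>z\<close> the previous visit, \<open>tower_map x\<close> is
    \<open>T z\<close>, and the first point of \<open>A\<close> met from there is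
    \<open>induced_map T A z\<close>, that is, \<open>x\<close>.\<close>
  have "induced_map T A (inv (induced_map T A) x) = x"
    using bij_induced_map by (simp add: bij_is_surj surj_f_inv_f)
  then show ?thesis
    using True entry_point_image_mem inv_induced_map(2)[OF True] by (simp add: entry_point_mem)
next
  case False
  obtain n where "(T ^^ n) x \<in> A" using sat_forward[OF assms] by blast
  then show ?thesis using False by (simp add: inv_induced_map(1) entry_point_not_mem)
qed

lemma tower_map_transversal: "partial_transversal tower_map A"
  unfolding partial_transversal_def
proof (intro ballI allI impI)
  fix x k assume x: "x \<in> A" "zpow tower_map k x \<in> A"
  \<comment> \<open>\<open>entry_point\<close> is known to be invariant only on the saturation of
    \<open>A\<close>; the value \<open>None\<close> elsewhere yields a function invariant at every
    point, as \<open>zpow_invariant\<close> asks.\<close>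
  define e where "e y = (if y \<in> sat T A then Some (entry_point T A y) else None)" for y
  have "e (tower_map y) = e y" for y
    unfolding e_def using sat_tower_map entry_point_tower_map by auto
  then have "e (zpow tower_map k x) = e x"
    using bij_tower_map by (rule zpow_invariant[rotated])
  then show "zpow tower_map k x = x"
    using x subset_sat[of A T] by (auto simp: e_def entry_point_mem split: if_splits)
qed

text \<open>Off \<open>A\<close> the tower map is \<open>T\<close>, so following it from
  \<open>x\<close> reaches \<open>A\<close> at the first visit of the
  \<open>T\<close>-orbit.\<close>

lemma sat_subset_sat_tower_map: "sat T A \<subseteq> sat tower_map A"
proof
  fix x assume "x \<in> sat T A"
  then obtain n where "(T ^^ n) x \<in> A" using sat_forward by blast
  then show "x \<in> sat tower_map A"
  proof (induction n arbitrary: x)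
    case 0
    then have "x \<in> A" by simp
    then show ?case by (rule subsetD[OF subset_sat])
  next
    case (Suc n)
    show ?case
    proof (cases "x \<in> A")
      case False
      then have "tower_map x = T x" by (simp add: inv_induced_map(1))
      moreover have "(T ^^ n) (T x) \<in> A" using Suc.prems by (simp add: funpow_swap1)
      ultimately show ?thesis using Suc.IH sat_step[OF bij_tower_map] by metis
    next
      case True
      then show ?thesis by (rule subsetD[OF subset_sat])
    qed
  qed
qed

end

section \<open>The factors: cocycles, conservativity, restriction\<close>

lemma induced_map_cocycle:
  assumes T: "bij_aut M T" and A: "A \<in> sets M"
  obtains \<kappa> where "\<kappa> \<in> measurable M (count_space UNIV)" "\<And>x. induced_map T A x = zpow T (\<kappa> x) x"
proof
  have pre: "Measurable.pred M (\<lambda>x. (T ^^ j) x \<in> A)" for j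
  proof -
    have "{x \<in> space M. (T ^^ j) x \<in> A} = space M \<inter> (T ^^ j) -` A" by auto
    then show ?thesis using bij_aut_vimage[OF bij_aut_funpow[OF T] A, of j] by (simp add: pred_def)
  qed
  have fr[measurable]: "first_return T A \<in> measurable M (count_space UNIV)"
    unfolding first_return_def using pre by (intro measurable_Least pred_intros_logic) auto
  note [measurable] = A
  show "(\<lambda>x. if x \<in> A then int (first_return T A x) else 0) \<in> measurable M (count_space UNIV)"
    by measurable
  show "induced_map T A x = zpow T (if x \<in> A then int (first_return T A x) else 0) x" for x
    by (simp add: induced_map_def zpow_of_nat)
qed

text \<open>Poincare recurrence: the points of \<open>C \<inter> A\<close> that never return to
  \<open>C\<close> have pairwise disjoint images of equal measure inside \<open>A\<close>, hence
  measure zero. Points off \<open>A\<close> are fixed and return at once.\<close>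

lemma finite_supp_conservative:
  assumes P: "bij_aut M P" and A: "A \<in> sets M" "emeasure M A \<noteq> \<infinity>"
    and idle: "\<And>x. x \<notin> A \<Longrightarrow> P x = x"
  shows "conservative M P"
  unfolding conservative_def
proof (intro ballI impI)
  fix C assume C: "C \<in> sets M"
  have PA: "P x \<in> A" if "x \<in> A" for x
    using that idle bij_aut_bij[OF P] by (metis bij_is_inj injD)
  then have PnA: "(P ^^ n) x \<in> A" if "x \<in> A" for x n
    using that by (induction n) auto
  note Pn = bij_aut_funpow[OF P]
  define B where "B = (C \<inter> A) - (\<Union>n. (P ^^ Suc n) -` C)"
  have B: "B \<in> sets M"
    unfolding B_def using bij_aut_vimage[OF Pn C] A(1) C by (auto intro!: sets.Diff sets.countable_UN'' simp del: funpow.simps)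
  have disj: "disjoint_family (\<lambda>n. (P ^^ n) ` B)"
  proof -
    have "(P ^^ i) x \<noteq> (P ^^ j) y" if "i < j" "x \<in> B" "y \<in> B" for i j x y
    proof
      assume "(P ^^ i) x = (P ^^ j) y"
      also have "\<dots> = (P ^^ i) ((P ^^ (j - i)) y)"
        using funpow_add[of i "j - i" P] that(1) by simp
      finally have "x = (P ^^ (j - i)) y"
        by (simp only: funpow_inj[OF bij_aut_bij[OF P]])
      also have "j - i = Suc (j - i - 1)" using that(1) by simp
      finally have "x = (P ^^ Suc (j - i - 1)) y" .
      then show False using that(2,3) by (auto simp: B_def)
    qed
    then have "(P ^^ i) ` B \<inter> (P ^^ j) ` B = {}" if "i < j" for i j
      using that by auto
    then show ?thesis
      unfolding disjoint_family_on_def by (metis Int_commute linorder_neqE_nat)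
  qed
  have "(\<Sum>n. emeasure M B) = (\<Sum>n. emeasure M ((P ^^ n) ` B))"
    by (simp add: bij_aut_emeasure[OF Pn B])
  also have "\<dots> = emeasure M (\<Union>n. (P ^^ n) ` B)"
    using disj bij_aut_image[OF Pn B] by (intro suminf_emeasure) auto
  also have "\<dots> \<le> emeasure M A"
    using PnA A(1) by (intro emeasure_mono) (auto simp: B_def)
  finally have le: "(\<Sum>n. emeasure M B) \<le> emeasure M A" .
  have "emeasure M B = 0"
  proof (rule ccontr)
    assume "emeasure M B \<noteq> 0"
    then have "(\<Sum>n::nat. emeasure M B) = \<infinity>"
      by (simp add: nn_integral_count_space_nat[symmetric] ennreal_mult_top)
    then show False using le A(2) by (simp add: top_unique)
  qed
  then have "B \<in> null_sets M" using B by auto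
  then show "AE x in M. x \<in> C \<longrightarrow> (\<exists>n\<ge>1. (P ^^ n) x \<in> C)"
  proof (rule AE_I')
    show "{x \<in> space M. \<not> (x \<in> C \<longrightarrow> (\<exists>n\<ge>1. (P ^^ n) x \<in> C))} \<subseteq> B"
    proof
      fix x assume "x \<in> {x \<in> space M. \<not> (x \<in> C \<longrightarrow> (\<exists>n\<ge>1. (P ^^ n) x \<in> C))}"
      then have x: "x \<in> C" "\<And>n. n \<ge> 1 \<Longrightarrow> (P ^^ n) x \<notin> C" by auto
      then have "P x \<noteq> x" using x(2)[of 1] by auto
      then have "x \<in> A" using idle by blast
      then show "x \<in> B" using x(1) x(2)[of "Suc _"] by (auto simp: B_def)
    qed
  qed
qed

lemma bij_image_eq_if_mem_iff:
  assumes "bij f" "\<And>x. f x \<in> A \<longleftrightarrow> x \<in> A"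
  shows "f ` A = A"
proof
  show "A \<subseteq> f ` A"
  proof
    fix y assume "y \<in> A"
    moreover obtain x where "y = f x" using assms(1) by (metis bij_is_surj surjD)
    ultimately show "y \<in> f ` A" using assms(2) by auto
  qed
qed (use assms(2) in auto)

lemma bij_if_invariant:
  assumes "bij U" "\<And>x. U x \<in> Y \<longleftrightarrow> x \<in> Y"
  shows "bij (\<lambda>x. if x \<in> Y then U x else x)"
proof (rule bijI)
  show "inj (\<lambda>x. if x \<in> Y then U x else x)"
    using assms by (intro injI) (metis bij_is_inj injD)
  show "surj (\<lambda>x. if x \<in> Y then U x else x)"
    unfolding surj_def
  proof
    fix y
    obtain x where "y = U x" using assms(1) by (metis bij_is_surj surjD)
    then show "\<exists>x. y = (if x \<in> Y then U x else x)"
      using assms(2) by (cases "y \<in> Y") auto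
  qed
qed

text \<open>With exponent 1 on \<open>Y\<close> and 0 elsewhere, the restricted map is pasted from
  powers of \<open>U\<close>.\<close>

lemma full_group_restrict:
  assumes G: "full_group M G" and U: "bij_aut M U" "U \<in> G"
    and Y: "Y \<in> sets M" "\<And>x. U x \<in> Y \<longleftrightarrow> x \<in> Y"
  shows "(\<lambda>x. if x \<in> Y then U x else x) \<in> G"
proof (rule full_group_cocycle[OF G U])
  show b: "bij (\<lambda>x. if x \<in> Y then U x else x)"
    by (rule bij_if_invariant[OF bij_aut_bij[OF U(1)] Y(2)])
  show "(\<lambda>x. if x \<in> Y then 1 else 0 :: int) \<in> measurable M (count_space UNIV)"
    using Y(1) by measurable
  show "(\<lambda>x. if x \<in> Y then U x else x) ` space M = space M"
  proof -
    have "(if x \<in> Y then U x else x) \<in> space M \<longleftrightarrow> x \<in> space M" for x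
      using bij_aut_space_iff[OF U(1)] by simp
    then show ?thesis by (rule bij_image_eq_if_mem_iff[OF b])
  qed
qed auto

section \<open>The factorisation\<close>

theorem proposition6p11:
  fixes M :: "'a measure" and T :: "'a \<Rightarrow> 'a" and D :: "'a set" and \<epsilon> :: real
  assumes "standard_sigma_finite_space M"
    and "T \<in> Aut M"
    and "D \<in> sets M" and "emeasure M D > 0"
    and "\<epsilon> > 0"
  shows "\<exists>T\<^sub>1 \<in> generated_full_group M T. \<exists>T\<^sub>2 \<in> generated_full_group M T.
         \<exists>T\<^sub>\<epsilon> \<in> generated_full_group M T.
           (AE x in M. T x = T\<^sub>1 (T\<^sub>2 (T\<^sub>\<epsilon> x))) \<and>
           supp M T\<^sub>1 \<inter> supp M T\<^sub>2 \<in> null_sets M \<and>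
           emeasure M (supp M T\<^sub>1) = emeasure M (supp M T\<^sub>2) \<and>
           emeasure M (supp M T\<^sub>1 \<inter> D) = emeasure M (supp M T\<^sub>2 \<inter> D) \<and>
           aperiodic_on_supp M T\<^sub>\<epsilon> \<and>
           emeasure M (supp M T\<^sub>\<epsilon>) < ennreal \<epsilon>"
proof -
  have sb: "standard_borel M" and sf: "sigma_finite_measure M" and al: "atomless M"
    using assms(1) by (auto simp: standard_sigma_finite_space_def)
  obtain S where S: "bij_aut M S" "\<And>x. x \<in> space M \<Longrightarrow> S x = T x"
    and SG: "\<And>G. full_group M G \<Longrightarrow> T \<in> G \<Longrightarrow> S \<in> G"
    using Aut_bij_aut_extension[OF assms(2)] by blast
  note bij = bij_aut_bij[OF S(1)]
  obtain \<phi> :: "'a \<Rightarrow> real" where phi[measurable]: "\<phi> \<in> borel_measurable M"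
    and phi_inj: "inj_on \<phi> (space M)"
    and phi': "\<And>x. 0 \<le> \<phi> x" "\<And>t. emeasure M {x\<in>space M. \<phi> x < t} < \<infinity>"
    using proper_injection[OF sb sf] by blast
  obtain A W where A: "A \<in> sets M" and W: "W \<in> sets M" and small: "emeasure M A < ennreal \<epsilon>"
    and tr: "partial_transversal S W" and disj: "A \<inter> sat S W = {}"
    and cover: "space M \<subseteq> sat S W \<union> sat S A"
    and fwd: "\<And>x. x \<in> A \<Longrightarrow> \<exists>j>0. (S ^^ j) x \<in> A"
    and bwd: "\<And>x. x \<in> A \<Longrightarrow> \<exists>j>0. zpow S (- int j) x \<in> A"
    and aper: "\<And>x m. x \<in> A \<Longrightarrow> m > 0 \<Longrightarrow> (S ^^ m) x \<noteq> x"
    using recurrent_markers[OF S(1) phi phi_inj phi' assms(5)] by blast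
  define P where "P = induced_map S A"
  define U where "U = S \<circ> inv P"
  have bijP: "bij P" unfolding P_def by (rule bij_induced_map[OF bij fwd bwd])
  obtain \<kappa> where kap: "\<kappa> \<in> measurable M (count_space UNIV)" "\<And>x. P x = zpow S (\<kappa> x) x"
    using induced_map_cocycle[OF S(1) A] unfolding P_def by blast
  have Psp: "P ` space M = space M"
  proof -
    have "P x \<in> space M \<longleftrightarrow> x \<in> space M" for x
      using bij_aut_space_iff[OF bij_aut_zpow[OF S(1)]] kap(2) by simp
    then show ?thesis by (rule bij_image_eq_if_mem_iff[OF bijP])
  qed
  have PA: "bij_aut M P" by (rule bij_aut_cocycle[OF S(1) bijP kap Psp])
  have UA: "bij_aut M U" unfolding U_def by (intro bij_aut_comp S(1) bij_aut_inv PA)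
  note bijU = bij_aut_bij[OF UA]
  have Pidle: "P x = x" if "x \<notin> A" for x using that by (simp add: P_def induced_map_def)
  have US: "U x = S x" if "x \<notin> A" for x
    using inv_induced_map(1)[OF bij fwd bwd] that by (simp add: U_def P_def)
  \<comment> \<open>\<open>A\<close> misses the saturation of \<open>W\<close>, so \<open>U\<close>
    and \<open>S\<close> agree on this invariant set and have the same orbits there.\<close>
  have zUS: "zpow U k x = zpow S k x" if "x \<in> sat S W" for k x
  proof (rule zpow_cong[OF bij bijU])
    show "S y \<in> sat S W \<longleftrightarrow> y \<in> sat S W" for y by (rule sat_step[OF bij])
    show "U y = S y" if "y \<in> sat S W" for y
      using that disj by (intro US) auto
  qed (rule that)
  have trA: "partial_transversal U A"
    unfolding U_def P_def by (rule tower_map_transversal[OF bij fwd bwd])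
  have WA: "W \<subseteq> sat S W" "A \<inter> W = {}" using subset_sat[of W S] disj by auto
  have apart: False if "x \<in> W" "zpow U k x \<in> A" for x k
    using that WA disj zUS[of x k] sat_zpow[OF bij, of k x W] by auto
  have trU: "partial_transversal U (W \<union> A)"
    unfolding partial_transversal_def
  proof (intro ballI allI impI)
    fix x k assume x: "x \<in> W \<union> A" "zpow U k x \<in> W \<union> A"
    \<comment> \<open>Running the orbit backwards, from the point in \<open>W\<close> to the one in
      \<open>A\<close>, reduces this case to \<open>apart\<close>.\<close>
    have "\<not> (x \<in> A \<and> zpow U k x \<in> W)"
      using apart[of "zpow U k x" "- k"] bijU by auto
    then consider "x \<in> W" "zpow U k x \<in> W" | "x \<in> A" "zpow U k x \<in> A"
      using x apart by blast
    then show "zpow U k x = x"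
    proof cases
      case 1
      then show ?thesis using tr WA(1) zUS[of x k] by (auto simp: partial_transversal_def)
    next
      case 2
      then show ?thesis using trA by (auto simp: partial_transversal_def)
    qed
  qed
  have coverU: "space M \<subseteq> sat U (W \<union> A)"
  proof -
    have "sat S W \<subseteq> sat U W"
    proof
      fix x assume x: "x \<in> sat S W"
      then obtain k where "zpow S k x \<in> W" by (auto simp: sat_def)
      then show "x \<in> sat U W" using zUS[OF x] by (intro satI[of _ k]) simp
    qed
    moreover have "sat S A \<subseteq> sat U A"
      unfolding U_def P_def by (rule sat_subset_sat_tower_map[OF bij fwd bwd])
    ultimately show ?thesis using cover by (auto simp: sat_Un)
  qed
  define E where "E = supp M U"
  have E: "E \<in> sets M"
  proof -
    have [measurable]: "U \<in> measurable M M" by (rule bij_aut_measurable[OF UA])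
    \<comment> \<open>The injective \<open>\<phi>\<close> turns inequality of points into inequality
      of measurable real functions.\<close>
    have "E = {x\<in>space M. \<phi> (U x) \<noteq> \<phi> x}"
      unfolding E_def supp_def
      using bij_aut_space_iff[OF UA] by (intro Collect_cong) (auto simp: inj_on_eq_iff[OF phi_inj])
    then show ?thesis by simp
  qed
  obtain Y where Y: "Y \<in> sets M" "\<And>x. U x \<in> Y \<longleftrightarrow> x \<in> Y"
    "emeasure M (E \<inter> Y) = emeasure M (E - Y)" "emeasure M (E \<inter> D \<inter> Y) = emeasure M (E \<inter> D - Y)"
    using invariant_halving[OF UA sets.Un[OF W A] trU coverU E sets.Int[OF E assms(3)] al phi phi_inj sf]
    by blast
  define T1 where "T1 x = (if x \<in> Y then U x else x)" for x
  \<comment> \<open>\<open>space M - Y\<close> replaces the full complement because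
    \<open>full_group_restrict\<close> needs a member of \<open>sets M\<close>.\<close>
  define T2 where "T2 x = (if x \<in> space M - Y then U x else x)" for x
  have group: "P \<in> G \<and> T1 \<in> G \<and> T2 \<in> G" if G: "full_group M G" "T \<in> G" for G
  proof -
    have "S \<in> G" by (rule SG[OF G])
    have PG: "P \<in> G" by (rule full_group_cocycle[OF G(1) S(1) \<open>S \<in> G\<close> bijP kap Psp])
    have UG: "U \<in> G"
      unfolding U_def by (intro full_group_comp[OF G(1) \<open>S \<in> G\<close>] full_group_inv[OF G(1) PA PG])
    have "T1 \<in> G"
      unfolding T1_def by (rule full_group_restrict[OF G(1) UA UG Y(1,2)])
    moreover have "T2 \<in> G"
      unfolding T2_def
      by (rule full_group_restrict[OF G(1) UA UG]) (use Y bij_aut_space_iff[OF UA] in auto)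
    ultimately show ?thesis using PG by blast
  qed
  have supp1: "supp M T1 = E \<inter> Y" by (auto simp: T1_def supp_def E_def)
  have supp2: "supp M T2 = E - Y" by (auto simp: T2_def supp_def E_def)
  have suppP: "supp M P \<subseteq> A" using Pidle by (auto simp: supp_def)
  have prod: "T x = T1 (T2 (P x))" if "x \<in> space M" for x
  proof -
    \<comment> \<open>Exactly one of the two maps applies \<open>U\<close>: by invariance of
      \<open>Y\<close>, a point moved by \<open>T2\<close> remains off \<open>Y\<close>, where
      \<open>T1\<close> is the identity.\<close>
    have "T1 (T2 y) = U y" if "y \<in> space M" for y using that by (simp add: T1_def T2_def Y(2))
    moreover have "P x \<in> space M" using that bij_aut_space_iff[OF PA] by simp
    moreover have "U (P x) = S x" using bijP by (simp add: U_def bij_is_inj)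
    ultimately show ?thesis using S(2)[OF that] by simp
  qed
  have "emeasure M A \<noteq> \<infinity>" using small by auto
  then have "conservative M P" by (rule finite_supp_conservative[OF PA A _ Pidle])
  moreover have "infinite (orbit M P x)" if "x \<in> supp M P" for x
  proof -
    have "inj (\<lambda>n. (P ^^ n) x)"
      using that suppP unfolding P_def by (intro induced_map_aperiodic[OF bij fwd bwd aper]) auto
    then show ?thesis using range_inj_infinite by (auto simp: orbit_def)
  qed
  ultimately have aperP: "aperiodic_on_supp M P" by (simp add: aperiodic_on_supp_def)
  have smallP: "emeasure M (supp M P) < ennreal \<epsilon>"
    using emeasure_mono[OF suppP A] small by (rule le_less_trans)
  have Dcut: "E \<inter> Y \<inter> D = E \<inter> D \<inter> Y" "(E - Y) \<inter> D = E \<inter> D - Y" by auto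
  have "supp M T1 \<inter> supp M T2 = {}" by (auto simp: supp1 supp2)
  then have "(AE x in M. T x = T1 (T2 (P x))) \<and> supp M T1 \<inter> supp M T2 \<in> null_sets M \<and>
      emeasure M (supp M T1) = emeasure M (supp M T2) \<and>
      emeasure M (supp M T1 \<inter> D) = emeasure M (supp M T2 \<inter> D) \<and>
      aperiodic_on_supp M P \<and> emeasure M (supp M P) < ennreal \<epsilon>"
    using prod Y(3,4) aperP smallP by (simp add: supp1 supp2 Dcut)
  moreover have "P \<in> generated_full_group M T" "T1 \<in> generated_full_group M T"
    "T2 \<in> generated_full_group M T"
    using group by (auto simp: generated_full_group_def)
  ultimately show ?thesis by blast
qed

end
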